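(* For every prime number $p$ there are, up to isomorphism, exactly $p$ indecomposable cycle sets of cardinality $p^2$ with cyclic permutation group: $p-1$ of them have multipermutational level $2$ and one has multipermutational level $1$. In particular, those having level $2$ are, up to isomorphism, given by $X:=\{0,\dots,p^2-1\}$ with $i\cdot j=\sigma_i(j):=t_1^{1+pf(i)}(j)$ for every $i,j\in X$, where $t_1:=(0\;1\;\dots\;p^2-1)\in Sym(X)$ and $f:\mathbb{Z}/p\mathbb{Z}\to\{0,\dots,p-1\}$ is one of the bijections $f(l)=\overline{lt}$ with $t\in\mathbb{Z}/p\mathbb{Z}$, $t\ne0$.
   Context: A cycle set is a non-empty set $X$ with a binary operation $\cdot$ such that every left multiplication $\sigma_x:X\to X,\ y\mapsto x\cdot y$ is bijective and $(x\cdot y)\cdot(x\cdot z)=(y\cdot x)\cdot(y\cdot z)$ for all $x,y,z\in X$. The permutation group $\mathcal{G}(X)$ is the subgroup of $Sym(X)$ generated by $\{\sigma_x\mid x\in X\}$. $X$ is indecomposable if there is no partition $\{Y,Z\}$ of $X$ into non-empty subsets with $\sigma_x(Y)\subseteq Y$ and $\sigma_x(Z)\subseteq Z$ for all $x\in X$ (equivalently, $\mathcal{G}(X)$ is transitive on $X$). For a non-degenerate cycle set (i.e. $x\mapsto x\cdot x$ is bijective; every finite cycle set is non-degenerate) the retraction is the cycle set $\sigma(X):=\{\sigma_x\mid x\in X\}$ with $\sigma_x\cdot\sigma_y:=\sigma_{x\cdot y}$; one puts $\sigma^0(X):=X$, $\sigma^m(X):=\sigma(\sigma^{m-1}(X))$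 for $m\ge1$. $X$ is multipermutational of level $m$ if $m$ is the minimal non-negative integer with $|\sigma^m(X)|=1$. For $u\in\mathbb{Z}/p\mathbb{Z}$, $\overline{u}$ denotes its representative in $\{0,\dots,p-1\}$; for an integer $i$, $f(i)$ means the value of $f$ at the class of $i$ modulo $p$. *)

theory Defs
  imports
    "HOL-Algebra.Bij"
    "HOL-Algebra.Elementary_Groups"
    "HOL-Combinatorics.Combinatorics"
    "HOL-Computational_Algebra.Primes"
begin

definition left_mult :: "'a set \<Rightarrow> ('a \<Rightarrow> 'a \<Rightarrow> 'a) \<Rightarrow> 'a \<Rightarrow> 'a \<Rightarrow> 'a" where
  "left_mult X m x = (\<lambda>y\<in>X. m x y)"

definition cycle_set :: "'a set \<Rightarrow> ('a \<Rightarrow> 'a \<Rightarrow> 'a) \<Rightarrow> bool" where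
  "cycle_set X m \<longleftrightarrow> X \<noteq> {} \<and> (\<forall>x\<in>X. bij_betw (m x) X X) \<and>
     (\<forall>x\<in>X. \<forall>y\<in>X. \<forall>z\<in>X. m (m x y) (m x z) = m (m y x) (m y z))"

definition non_degenerate :: "'a set \<Rightarrow> ('a \<Rightarrow> 'a \<Rightarrow> 'a) \<Rightarrow> bool" where
  "non_degenerate X m \<longleftrightarrow> bij_betw (\<lambda>x. m x x) X X"

definition permutation_group :: "'a set \<Rightarrow> ('a \<Rightarrow> 'a \<Rightarrow> 'a) \<Rightarrow> ('a \<Rightarrow> 'a) monoid" where
  "permutation_group X m = subgroup_generated (BijGroup X) (left_mult X m ` X)"

definition indecomposable :: "'a set \<Rightarrow> ('a \<Rightarrow> 'a \<Rightarrow> 'a) \<Rightarrow> bool" where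
  "indecomposable X m \<longleftrightarrow>
     \<not> (\<exists>Y Z. Y \<noteq> {} \<and> Z \<noteq> {} \<and> Y \<inter> Z = {} \<and> Y \<union> Z = X \<and>
          (\<forall>x\<in>X. m x ` Y \<subseteq> Y \<and> m x ` Z \<subseteq> Z))"

definition cycle_set_iso ::
  "'a set \<Rightarrow> ('a \<Rightarrow> 'a \<Rightarrow> 'a) \<Rightarrow> 'b set \<Rightarrow> ('b \<Rightarrow> 'b \<Rightarrow> 'b) \<Rightarrow> bool" where
  "cycle_set_iso X m Y n \<longleftrightarrow>
     (\<exists>h. bij_betw h X Y \<and> (\<forall>x\<in>X. \<forall>y\<in>X. h (m x y) = n (h x) (h y)))"

definition retraction_carrier :: "'a set \<Rightarrow> ('a \<Rightarrow> 'a \<Rightarrow> 'a) \<Rightarrow> ('a \<Rightarrow> 'a) set" where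
  "retraction_carrier X m = left_mult X m ` X"

text \<open>An element of \<^term>\<open>X\<close> inducing a given left multiplication.\<close>

definition retraction_rep :: "'a set \<Rightarrow> ('a \<Rightarrow> 'a \<Rightarrow> 'a) \<Rightarrow> ('a \<Rightarrow> 'a) \<Rightarrow> 'a" where
  "retraction_rep X m = inv_into X (left_mult X m)"

definition retraction_mult ::
  "'a set \<Rightarrow> ('a \<Rightarrow> 'a \<Rightarrow> 'a) \<Rightarrow> ('a \<Rightarrow> 'a) \<Rightarrow> ('a \<Rightarrow> 'a) \<Rightarrow> 'a \<Rightarrow> 'a" where
  "retraction_mult X m F G =
     left_mult X m (m (retraction_rep X m F) (retraction_rep X m G))"

text \<open>The choice of representatives in \<^const>\<open>retraction_mult\<close> is immaterial.\<close>

lemma retraction_mult_left_mult: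
  assumes "cycle_set X m" and "x \<in> X" and "y \<in> X"
  shows "retraction_mult X m (left_mult X m x) (left_mult X m y) = left_mult X m (m x y)"
proof -
  have closed: "m a b \<in> X" if "a \<in> X" "b \<in> X" for a b
    using assms(1) that by (auto simp: cycle_set_def bij_betw_def)
  have cyc: "m (m a b) (m a c) = m (m b a) (m b c)" if "a \<in> X" "b \<in> X" "c \<in> X" for a b c
    using assms(1) that by (auto simp: cycle_set_def)
  have rep: "retraction_rep X m (left_mult X m a) \<in> X"
    "left_mult X m (retraction_rep X m (left_mult X m a)) = left_mult X m a" if "a \<in> X" for a
    using that by (auto simp: retraction_rep_def inv_into_into f_inv_into_f)
  have eqD: "m a c = m b c" if "left_mult X m a = left_mult X m b" "c \<in> X" for a b c
    using fun_cong[OF that(1), of c] that(2) by (simp add: left_mult_def)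
  define x' where "x' = retraction_rep X m (left_mult X m x)"
  define y' where "y' = retraction_rep X m (left_mult X m y)"
  have x': "x' \<in> X" "left_mult X m x' = left_mult X m x"
    and y': "y' \<in> X" "left_mult X m y' = left_mult X m y"
    using rep assms by (auto simp: x'_def y'_def)
  have 1: "m x' y' = m x y'" using eqD x' y' by blast
  have 2: "m (m x y') w = m (m x y) w" if w: "w \<in> X" for w
  proof -
    have "m x ` X = X" using assms by (auto simp: cycle_set_def bij_betw_def)
    then obtain z where z: "z \<in> X" "w = m x z" using w by blast
    have "m (m x y') (m x z) = m (m y' x) (m y' z)" using cyc assms y' z by blast
    also have "\<dots> = m (m y x) (m y z)" using eqD[OF y'(2)] assms z by simp
    also have "\<dots> = m (m x y) (m x z)" using cyc assms z by metis
    finally show ?thesis using z by simp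
  qed
  show ?thesis
    unfolding retraction_mult_def x'_def[symmetric] y'_def[symmetric] 1
    using 2 by (auto simp: left_mult_def restrict_def)
qed

text \<open>
  The retraction of a cycle set on \<^typ>\<open>'a\<close> lives on \<^typ>\<open>'a \<Rightarrow> 'a\<close>, so it cannot be
  iterated by a function of fixed type. It is therefore transported back to \<^typ>\<open>'a\<close> along
  the injection \<^const>\<open>retraction_rep\<close>; \<open>retract_iso_retraction\<close> below shows that this yields
  an isomorphic copy.
\<close>

fun retract :: "'a set \<times> ('a \<Rightarrow> 'a \<Rightarrow> 'a) \<Rightarrow> 'a set \<times> ('a \<Rightarrow> 'a \<Rightarrow> 'a)" where
  "retract (X, m) =
     (retraction_rep X m ` retraction_carrier X m,
      \<lambda>x y. retraction_rep X m (retraction_mult X m (left_mult X m x) (left_mult X m y)))"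

lemma retract_iso_retraction:
  assumes "cycle_set X m"
  shows "cycle_set_iso (retraction_carrier X m) (retraction_mult X m)
           (fst (retract (X, m))) (snd (retract (X, m)))"
proof -
  let ?r = "retraction_rep X m"
  have lr: "left_mult X m (?r F) = F" if "F \<in> retraction_carrier X m" for F
    using that by (auto simp: retraction_rep_def retraction_carrier_def f_inv_into_f)
  have "bij_betw ?r (retraction_carrier X m) (?r ` retraction_carrier X m)"
    using lr by (metis inj_on_imp_bij_betw inj_on_inverseI)
  then show ?thesis
    using lr by (auto simp: cycle_set_iso_def intro!: exI[of _ ?r])
qed

definition retraction_card :: "nat \<Rightarrow> 'a set \<Rightarrow> ('a \<Rightarrow> 'a \<Rightarrow> 'a) \<Rightarrow> nat" where
  "retraction_card k X m = card (fst ((retract ^^ k) (X, m)))"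

definition multipermutational_level :: "'a set \<Rightarrow> ('a \<Rightarrow> 'a \<Rightarrow> 'a) \<Rightarrow> nat \<Rightarrow> bool" where
  "multipermutational_level X m k \<longleftrightarrow>
     non_degenerate X m \<and> retraction_card k X m = 1 \<and> (\<forall>j<k. retraction_card j X m \<noteq> 1)"

definition indec_cyclic :: "nat \<Rightarrow> ('a set \<times> ('a \<Rightarrow> 'a \<Rightarrow> 'a)) set" where
  "indec_cyclic n = {(X, m). cycle_set X m \<and> card X = n \<and> indecomposable X m \<and>
     cyclic_group (permutation_group X m)}"

definition indec_cyclic_level :: "nat \<Rightarrow> nat \<Rightarrow> ('a set \<times> ('a \<Rightarrow> 'a \<Rightarrow> 'a)) set" where
  "indec_cyclic_level n k = {(X, m). (X, m) \<in> indec_cyclic n \<and> multipermutational_level X m k}"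

definition iso_rel :: "(('a set \<times> ('a \<Rightarrow> 'a \<Rightarrow> 'a)) \<times> ('a set \<times> ('a \<Rightarrow> 'a \<Rightarrow> 'a))) set" where
  "iso_rel = {((X, m), (Y, n)). cycle_set X m \<and> cycle_set Y n \<and> cycle_set_iso X m Y n}"

lemma equiv_iso_rel:
  "equiv {(X :: 'a set, m). cycle_set X m} iso_rel"
proof (rule equivI)
  show "iso_rel \<subseteq> {(X, m). cycle_set X m} \<times> {(X, m). cycle_set X m}"
    by (auto simp: iso_rel_def)
  show "refl_on {(X, m). cycle_set X m} iso_rel"
    by (auto simp: refl_on_def iso_rel_def cycle_set_iso_def intro!: exI[of _ id])
  show "sym (iso_rel :: (('a set \<times> _) \<times> _) set)"
  proof (rule symI)
    fix P Q :: "'a set \<times> ('a \<Rightarrow> 'a \<Rightarrow> 'a)"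
    assume "(P, Q) \<in> iso_rel"
    then obtain X m Y n h where PQ: "P = (X, m)" "Q = (Y, n)"
      and c: "cycle_set X m" "cycle_set Y n" and h: "bij_betw h X Y"
      and hom: "\<And>x y. x \<in> X \<Longrightarrow> y \<in> X \<Longrightarrow> h (m x y) = n (h x) (h y)"
      by (auto simp: iso_rel_def cycle_set_iso_def)
    have "inv_into X h (n u v) = m (inv_into X h u) (inv_into X h v)" if uv: "u \<in> Y" "v \<in> Y" for u v
    proof -
      let ?a = "inv_into X h u" and ?b = "inv_into X h v"
      have ab: "?a \<in> X" "?b \<in> X" "h ?a = u" "h ?b = v"
        using uv h by (auto simp: bij_betw_def inv_into_into f_inv_into_f)
      moreover have "m ?a ?b \<in> X" using c(1) ab by (auto simp: cycle_set_def bij_betw_def)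
      ultimately show ?thesis using hom[of ?a ?b] h by (metis bij_betw_inv_into_left)
    qed
    then show "(Q, P) \<in> iso_rel"
      using PQ c bij_betw_inv_into[OF h] by (auto simp: iso_rel_def cycle_set_iso_def)
  qed
  show "trans (iso_rel :: (('a set \<times> _) \<times> _) set)"
  proof (rule transI)
    fix P Q R :: "'a set \<times> ('a \<Rightarrow> 'a \<Rightarrow> 'a)"
    assume PQ: "(P, Q) \<in> iso_rel" and QR: "(Q, R) \<in> iso_rel"
    obtain X m Y n Z k where eqs: "P = (X, m)" "Q = (Y, n)" "R = (Z, k)"
      by (metis surj_pair)
    note 1 = PQ[unfolded eqs] and 2 = QR[unfolded eqs]
    obtain g where g: "bij_betw g X Y" "\<forall>x\<in>X. \<forall>y\<in>X. g (m x y) = n (g x) (g y)"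
      using 1 by (auto simp: iso_rel_def cycle_set_iso_def)
    obtain h where h: "bij_betw h Y Z" "\<forall>x\<in>Y. \<forall>y\<in>Y. h (n x y) = k (h x) (h y)"
      using 2 by (auto simp: iso_rel_def cycle_set_iso_def)
    have "bij_betw (h \<circ> g) X Z" using g(1) h(1) by (rule bij_betw_trans)
    moreover have "\<forall>x\<in>X. \<forall>y\<in>X. (h \<circ> g) (m x y) = k ((h \<circ> g) x) ((h \<circ> g) y)"
      using g h by (auto simp: bij_betw_def)
    ultimately show "(P, R) \<in> iso_rel"
      using 1 2 unfolding eqs iso_rel_def cycle_set_iso_def by blast
  qed
qed

definition standard_cycle :: "nat \<Rightarrow> nat \<Rightarrow> nat" where
  "standard_cycle p = cycle_of_list [0..<p^2]"

text \<open>
  Residue classes modulo \<^term>\<open>p\<close> are given by arbitrary natural-number representatives;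
  \<^term>\<open>residue_scale p t l\<close> depends only on the classes of \<^term>\<open>t\<close> and \<^term>\<open>l\<close>.
\<close>

definition residue_scale :: "nat \<Rightarrow> nat \<Rightarrow> nat \<Rightarrow> nat" where
  "residue_scale p t l = (l * t) mod p"

definition standard_mult :: "nat \<Rightarrow> (nat \<Rightarrow> nat) \<Rightarrow> nat \<Rightarrow> nat \<Rightarrow> nat" where
  "standard_mult p f i j = (standard_cycle p ^^ (1 + p * f i)) j"

end

theory Submission
  imports Defs "HOL-Number_Theory.Cong" "HOL-Algebra.Multiplicative_Group"
begin

text \<open>
  A transitive cyclic permutation group is regular, so an indecomposable cycle set \<open>X\<close> of size \<open>n\<close>
  with cyclic permutation group can be identified with \<open>\<int>/n\<int>\<close> in such a way that every left
  multiplication is a translation: \<open>i \<cdot> j = j + \<phi> i\<close>. The cycle set equation then says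
  \<open>\<phi> x + \<phi> (y + \<phi> x) = \<phi> y + \<phi> (x + \<phi> y)\<close> modulo \<open>n\<close>, and for a prime power \<open>n\<close>
  indecomposability says that some value of \<open>\<phi>\<close> is a unit.

  The heart of the proof is that for \<open>n = p\<^sup>k\<close> with \<open>k > 0\<close> such a \<open>\<phi>\<close> has a nonzero period
  (\<open>exists_nontrivial_period\<close>). The maps \<open>\<theta>\<^sub>x s = s + \<phi> (x + s)\<close> commute with each other;
  that is what the equation expresses. Since \<open>\<phi>\<close> takes a unit value, the monoid they generate is
  transitive. A commutative transitive monoid of maps is a regular permutation group, so it has
  exactly \<open>p\<^sup>k\<close> elements. Conjugation by the translation \<open>s \<mapsto> s + 1\<close> maps \<open>\<theta>\<^sub>x\<close> to \<open>\<theta>\<^sub>x\<^sub>-\<^sub>1\<close>,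
  hence acts on this \<open>p\<close>-group as a permutation of \<open>p\<close>-power order, and counting fixed points modulo
  \<open>p\<close> yields a nontrivial element that commutes with the translation. This element is itself a
  translation by some \<open>c \<noteq> 0\<close>, and because it commutes with all \<open>\<theta>\<^sub>x\<close>, \<open>c\<close> is a period of \<open>\<phi>\<close>.
  (In the language of braces: the permutation group is a brace with abelian multiplicative group of
  prime power order, and such a brace has a nontrivial socle.)

  For \<open>n = p\<^sup>2\<close> this is applied twice. Modulo \<open>p\<^sup>2\<close> it shows that \<open>p\<close> is a period; therefore the
  equation also makes sense modulo \<open>p\<close>, where a nonzero period forces \<open>\<phi>\<close> to be constant. Now
  \<open>\<phi> (y + \<phi> x) = \<phi> (y + \<phi> 0)\<close> modulo \<open>p\<^sup>2\<close>, and the equation says that \<open>\<phi>\<close> has constant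
  differences along steps of length \<open>\<phi> 0\<close>, so that it is affine. Rescaling the coordinate by the unit
  \<open>\<phi> 0\<close> brings it to the form \<open>\<phi> i = 1 + p t i\<close> with \<open>0 \<le> t < p\<close>, which is the cycle set of the
  classification for \<open>f l = l t mod p\<close>.

  Conversely each of these \<open>p\<close> maps \<open>\<phi>\<close> defines a cycle set. An isomorphism between two of them is
  an affine map of \<open>\<int>/p\<^sup>2\<int>\<close> whose slope is congruent to \<open>1\<close> modulo \<open>p\<close>, and comparing both sides
  gives equal parameters \<open>t\<close>. The level is \<open>1\<close> if all left multiplications coincide, i.e. if
  \<open>t = 0\<close>, and it is \<open>2\<close> otherwise because \<open>\<sigma>\<^sub>i\<close> depends only on \<open>i\<close> modulo \<open>p\<close> and all left
  multiplications induce the same map on residues modulo \<open>p\<close>.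
\<close>

section \<open>Orbits of a map of prime power order\<close>

lemma funpow_eq_iff_cong_card_orbit:
  assumes "x \<in> orbit f x"
  shows "(f ^^ i) x = (f ^^ j) x \<longleftrightarrow> [i = j] (mod card (orbit f x))"
proof -
  let ?d = "funpow_dist1 f x x"
  have card: "card (orbit f x) = ?d"
    using card_image[OF inj_on_funpow_dist1[OF assms]] orbit_conv_funpow_dist1[OF assms] by simp
  have mod: "(f ^^ (k mod ?d)) x = (f ^^ k) x" for k
    by (rule funpow_mod_eq[OF funpow_dist1_prop[OF assms]])
  have "(f ^^ i) x = (f ^^ j) x \<longleftrightarrow> (f ^^ (i mod ?d)) x = (f ^^ (j mod ?d)) x"
    by (simp only: mod)
  also have "\<dots> \<longleftrightarrow> i mod ?d = j mod ?d"
    using inj_on_eq_iff[OF inj_on_funpow_dist1[OF assms], of "i mod ?d" "j mod ?d"] by simp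
  finally show ?thesis by (simp only: card cong_def)
qed

text \<open>
  The points that are moved fall into orbits whose lengths divide \<open>p ^ k\<close> and differ from \<open>1\<close>. This is
  the fixed point congruence for \<open>p\<close>-groups in the special case of a cyclic group.
\<close>

lemma prime_dvd_card_moved_points:
  assumes p: "prime p" and fin: "finite S" and closed: "\<And>x. x \<in> S \<Longrightarrow> f x \<in> S"
    and ord: "\<And>x. x \<in> S \<Longrightarrow> (f ^^ (p ^ k)) x = x"
  shows "p dvd card {x \<in> S. f x \<noteq> x}"
proof -
  have self: "x \<in> orbit f x" if "x \<in> S" for x
    unfolding orbit_altdef
    using ord[OF that, symmetric] prime_gt_0_nat[OF p] by (intro CollectI exI[of _ "p ^ k"]) simp
  have sub: "orbit f x \<subseteq> {x \<in> S. f x \<noteq> x}" if x: "x \<in> S" "f x \<noteq> x" for x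
  proof
    fix y assume y: "y \<in> orbit f x"
    have "y \<in> S" using y by induction (use closed x in auto)
    moreover have "f y \<noteq> y"
    proof
      assume "f y = y"
      then have "orbit f y = {y}" by (simp add: orbit_eq_singleton_iff)
      moreover have "x \<in> orbit f y" using y self[OF x(1)] by (rule orbit_swap[rotated])
      ultimately show False using x(2) \<open>f y = y\<close> by simp
    qed
    ultimately show "y \<in> {x \<in> S. f x \<noteq> x}" by simp
  qed
  have "p dvd card (orbit f x)" if x: "x \<in> S" "f x \<noteq> x" for x
  proof -
    have "card (orbit f x) dvd p ^ k"
      using funpow_eq_iff_cong_card_orbit[OF self[OF x(1)], of "p ^ k" 0] ord[OF x(1)]
      by (simp add: cong_0_iff)
    then obtain i where i: "card (orbit f x) = p ^ i"
      using divides_primepow_nat[OF p] by blast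
    have "i \<noteq> 0"
    proof
      assume "i = 0"
      then show False
        using funpow_eq_iff_cong_card_orbit[OF self[OF x(1)], of 1 0] i x(2) by simp
    qed
    then show ?thesis using i by simp
  qed
  then have "p dvd card (\<Union> (orbit f ` {x \<in> S. f x \<noteq> x}))"
  proof (intro dvd_partition)
    have "\<Union> (orbit f ` {x \<in> S. f x \<noteq> x}) \<subseteq> S" using sub by blast
    then show "finite (\<Union> (orbit f ` {x \<in> S. f x \<noteq> x}))" using fin finite_subset by blast
    show "\<forall>c1\<in>orbit f ` {x \<in> S. f x \<noteq> x}. \<forall>c2\<in>orbit f ` {x \<in> S. f x \<noteq> x}.
        c1 \<noteq> c2 \<longrightarrow> c1 \<inter> c2 = {}"
    proof (clarsimp, rule ccontr)
      fix x y assume x: "x \<in> S" and y: "y \<in> S" and ne: "orbit f x \<noteq> orbit f y"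
        and "orbit f x \<inter> orbit f y \<noteq> {}"
      then obtain z where "z \<in> orbit f x" "z \<in> orbit f y" by blast
      then have "orbit f x = orbit f y"
        using self[OF x] self[OF y] by (meson orbit_swap orbit_trans subset_antisym subsetI)
      then show False using ne by simp
    qed
  qed blast
  moreover have "\<Union> (orbit f ` {x \<in> S. f x \<noteq> x}) = {x \<in> S. f x \<noteq> x}"
    using sub self by blast
  ultimately show ?thesis by simp
qed

section \<open>Periods of solutions of the translation law\<close>

text \<open>
  The law is the cycle set equation of \<open>i \<cdot> j = j + \<phi> i\<close> on \<open>\<int>/n\<int>\<close>. Residue classes are
  represented by arbitrary integers, so that one and the same \<open>\<phi>\<close> can be studied for several moduli:
  later it satisfies the law modulo \<open>p\<^sup>2\<close> and modulo \<open>p\<close>.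
\<close>

locale translation_law =
  fixes n :: nat and \<phi> :: "int \<Rightarrow> int"
  assumes n_pos: "0 < n"
    and cong_arg: "\<And>x y. [x = y] (mod int n) \<Longrightarrow> [\<phi> x = \<phi> y] (mod int n)"
    and law: "\<And>x y. [\<phi> x + \<phi> (y + \<phi> x) = \<phi> y + \<phi> (x + \<phi> y)] (mod int n)"
begin

text \<open>
  The residue \<open>s\<close> stands for the translation by \<open>s\<close>; this moves the point \<open>x\<close> to \<open>x + s\<close>, and
  \<open>\<theta> x\<close> composes it with the left multiplication by \<open>x + s\<close>. Up to inversion this is addition of
  the generator belonging to \<open>x\<close> in the brace structure of the permutation group.
\<close>

definition \<theta> :: "int \<Rightarrow> int \<Rightarrow> int" where
  "\<theta> x s = (s + \<phi> (x + s)) mod int n"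

text \<open>
  The monoid generated by the maps \<open>\<theta> x\<close>. Its elements are extended to all integers in such a way
  that they are constant on residue classes and have values in \<open>{0..<n}\<close>; equality of functions then
  is equality as maps of \<open>\<int>/n\<int>\<close>, and the neutral element is reduction modulo \<open>n\<close>.
\<close>

inductive_set \<Theta> :: "(int \<Rightarrow> int) set" where
  one: "(\<lambda>s. s mod int n) \<in> \<Theta>"
| step: "a \<in> \<Theta> \<Longrightarrow> (\<lambda>s. \<theta> x (a s)) \<in> \<Theta>"

lemma \<theta>_cong: "[s = s'] (mod int n) \<Longrightarrow> [x = x'] (mod int n) \<Longrightarrow> \<theta> x s = \<theta> x' s'"
  unfolding \<theta>_def cong_def[symmetric] by (intro cong_add cong_arg)

lemma \<theta>_cong_sum: "[\<theta> x s = s + \<phi> (x + s)] (mod int n)"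
  by (simp add: \<theta>_def)

text \<open>
  Both composites send \<open>s\<close> to \<open>s\<close> plus one side of the law at the points \<open>x + s\<close> and \<open>y + s\<close>.
\<close>

lemma \<theta>_comm: "\<theta> x (\<theta> y s) = \<theta> y (\<theta> x s)"
proof -
  have *: "[\<theta> x (\<theta> y s) = s + (\<phi> (y + s) + \<phi> ((x + s) + \<phi> (y + s)))] (mod int n)" for x y
  proof -
    have "[\<theta> x (\<theta> y s) = \<theta> y s + \<phi> (x + \<theta> y s)] (mod int n)" by (rule \<theta>_cong_sum)
    also have "[\<theta> y s + \<phi> (x + \<theta> y s) = (s + \<phi> (y + s)) + \<phi> (x + (s + \<phi> (y + s)))] (mod int n)"
      by (intro cong_add cong_arg \<theta>_cong_sum cong_refl)
    finally show ?thesis by (simp add: algebra_simps)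
  qed
  have "[\<theta> x (\<theta> y s) = \<theta> y (\<theta> x s)] (mod int n)"
    using cong_trans[OF * cong_sym[OF cong_trans[OF * cong_add[OF cong_refl law]]]] .
  then show ?thesis by (simp add: cong_def \<theta>_def)
qed

lemma \<Theta>_cong: "a \<in> \<Theta> \<Longrightarrow> [s = s'] (mod int n) \<Longrightarrow> a s = a s'"
  by (induction rule: \<Theta>.induct) (auto simp: cong_def)

lemma \<Theta>_mod: "a \<in> \<Theta> \<Longrightarrow> a s mod int n = a s"
  by (induction rule: \<Theta>.induct) (auto simp: \<theta>_def)

lemma \<Theta>_\<theta>: "a \<in> \<Theta> \<Longrightarrow> a (\<theta> x s) = \<theta> x (a s)"
proof (induction rule: \<Theta>.induct)
  case one
  have "\<theta> x s = \<theta> x (s mod int n)" by (rule \<theta>_cong) (auto simp: cong_def)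
  then show ?case by (simp add: \<theta>_def)
qed (simp add: \<theta>_comm)

lemma \<Theta>_comm: "a \<in> \<Theta> \<Longrightarrow> b \<in> \<Theta> \<Longrightarrow> a (b s) = b (a s)"
proof (induction rule: \<Theta>.induct)
  case one
  then show ?case
    using \<Theta>_mod[of b s] \<Theta>_cong[of b "s mod int n" s] by (simp add: cong_def)
qed (simp add: \<Theta>_\<theta>)

text \<open>
  Conjugating \<open>\<theta> x\<close> by the translation \<open>s \<mapsto> s + 1\<close> gives \<open>\<theta> (x - 1)\<close>, so the translation
  normalises the monoid.
\<close>

lemma \<Theta>_conj: "a \<in> \<Theta> \<Longrightarrow> (\<lambda>s. (1 + a (s - 1)) mod int n) \<in> \<Theta>"
proof (induction rule: \<Theta>.induct)
  case one
  show ?case using \<Theta>.one by (simp add: mod_simps)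
next
  case (step a x)
  have "(1 + \<theta> x (a (s - 1))) mod int n = \<theta> (x - 1) ((1 + a (s - 1)) mod int n)" for s
  proof -
    have "\<theta> (x - 1) ((1 + a (s - 1)) mod int n) = \<theta> (x - 1) (1 + a (s - 1))"
      by (rule \<theta>_cong) auto
    then show ?thesis by (simp add: \<theta>_def mod_simps algebra_simps)
  qed
  then show ?case using \<Theta>.step[OF step.IH, of "x - 1"] by simp
qed

end

locale transitive_translation_law = translation_law +
  fixes x\<^sub>0 :: int
  assumes unit: "coprime (\<phi> x\<^sub>0) (int n)"
begin

text \<open>
  The generator \<open>\<theta> (x\<^sub>0 - s)\<close> moves the position \<open>s\<close> by exactly \<open>\<phi> x\<^sub>0\<close>. Repeating
  such steps reaches every residue, because \<open>\<phi> x\<^sub>0\<close> is a unit.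
\<close>

lemma \<Theta>_transitive: "\<exists>a\<in>\<Theta>. a r = s mod int n"
proof -
  have *: "\<exists>a\<in>\<Theta>. a r = (r + int k * \<phi> x\<^sub>0) mod int n" for k
  proof (induction k)
    case 0
    show ?case using \<Theta>.one by force
  next
    case (Suc k)
    then obtain a where a: "a \<in> \<Theta>" "a r = (r + int k * \<phi> x\<^sub>0) mod int n" by blast
    have "\<theta> (x\<^sub>0 - a r) (a r) = (r + int (Suc k) * \<phi> x\<^sub>0) mod int n"
      by (simp add: \<theta>_def a(2) mod_simps algebra_simps)
    then show ?case by (rule bexI[OF _ \<Theta>.step[OF a(1)]])
  qed
  obtain v where v: "[\<phi> x\<^sub>0 * v = 1] (mod int n)"
    using cong_solve_coprime_int[OF unit] by blast
  define k where "k = nat ((v * (s - r)) mod int n)"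
  have "int k = (v * (s - r)) mod int n" using n_pos by (simp add: k_def)
  then have "[int k * \<phi> x\<^sub>0 = (v * (s - r)) * \<phi> x\<^sub>0] (mod int n)"
    by (intro cong_mult) auto
  also have "[(v * (s - r)) * \<phi> x\<^sub>0 = s - r] (mod int n)"
    using cong_mult[OF v cong_refl[of "s - r"]] by (simp add: algebra_simps)
  finally have "[r + int k * \<phi> x\<^sub>0 = s] (mod int n)"
    by (metis cong_add_lcancel diff_add_cancel add.commute)
  then show ?thesis using *[of k] by (simp add: cong_def)
qed

text \<open>
  Commutativity and transitivity imply regularity: an element is determined by a single value.
\<close>

lemma \<Theta>_eqI:
  assumes "a \<in> \<Theta>" "b \<in> \<Theta>" "a r = b r"
  shows "a = b"
proof
  fix s
  obtain c where c: "c \<in> \<Theta>" "c r = s mod int n" using \<Theta>_transitive by blast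
  have "a (c r) = b (c r)" 
    using assms(3) \<Theta>_comm[OF assms(1) c(1), of r] \<Theta>_comm[OF assms(2) c(1), of r] by simp
  then show "a s = b s"
    using \<Theta>_cong[OF assms(1), of "s mod int n" s] \<Theta>_cong[OF assms(2), of "s mod int n" s] c(2)
    by (simp add: cong_def)
qed

lemma bij_betw_\<Theta>: "bij_betw (\<lambda>a. a 0) \<Theta> {0..<int n}"
proof (rule bij_betw_imageI)
  show "inj_on (\<lambda>a. a 0) \<Theta>" using \<Theta>_eqI by (auto intro: inj_onI)
  show "(\<lambda>a. a 0) ` \<Theta> = {0..<int n}"
  proof (intro equalityI subsetI)
    fix s assume "s \<in> (\<lambda>a. a 0) ` \<Theta>"
    then obtain a where "a \<in> \<Theta>" "s = a 0 mod int n" using \<Theta>_mod by force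
    then show "s \<in> {0..<int n}" using n_pos by simp
  next
    fix s assume "s \<in> {0..<int n}"
    then show "s \<in> (\<lambda>a. a 0) ` \<Theta>" using \<Theta>_transitive[of 0 s] by force
  qed
qed

text \<open>
  By regularity there are \<open>p ^ k\<close> elements in \<open>\<Theta>\<close>, on which conjugation \<open>\<tau>\<close> by the translation
  \<open>s \<mapsto> s + 1\<close> acts with order dividing \<open>p ^ k\<close>. The number of fixed points is divisible by \<open>p\<close>, and the
  neutral element is one of them, so there is another one, \<open>a\<close>. Being invariant under \<open>\<tau>\<close>, it is
  the translation by \<open>c = a 0\<close>, and commuting with \<open>\<theta> x\<close> it satisfies \<open>\<phi> (x + c) = \<phi> x\<close>.
\<close>

theorem exists_nontrivial_period:
  assumes p: "prime p" and n: "n = p ^ k" and k: "0 < k"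
  shows "\<exists>c. \<not> int n dvd c \<and> (\<forall>x. [\<phi> (x + c) = \<phi> x] (mod int n))"
proof -
  define \<tau> :: "(int \<Rightarrow> int) \<Rightarrow> int \<Rightarrow> int" where "\<tau> a = (\<lambda>s. (1 + a (s - 1)) mod int n)" for a
  have \<tau>_pow: "(\<tau> ^^ i) a = (\<lambda>s. (int i + a (s - int i)) mod int n)" if "a \<in> \<Theta>" for a i
  proof (induction i)
    case 0
    show ?case using \<Theta>_mod[OF that] by simp
  next
    case (Suc i)
    then show ?case by (simp add: \<tau>_def mod_simps algebra_simps)
  qed
  have "\<tau> a \<in> \<Theta>" if "a \<in> \<Theta>" for a
    using \<Theta>_conj[OF that] by (simp add: \<tau>_def)
  moreover have "(\<tau> ^^ (p ^ k)) a = a" if "a \<in> \<Theta>" for a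
  proof -
    have "a (s - int n) = a s" for s by (rule \<Theta>_cong[OF that]) (simp add: cong_def)
    then show ?thesis using \<Theta>_mod[OF that] by (simp add: \<tau>_pow[OF that] flip: n of_nat_power)
  qed
  moreover have fin: "finite \<Theta>" and card: "card \<Theta> = n"
    using bij_betw_finite[OF bij_betw_\<Theta>] bij_betw_same_card[OF bij_betw_\<Theta>] by auto
  ultimately have moved: "p dvd card {a \<in> \<Theta>. \<tau> a \<noteq> a}"
    using p by (intro prime_dvd_card_moved_points[where k = k]) simp_all
  have "card \<Theta> = card {a \<in> \<Theta>. \<tau> a = a} + card {a \<in> \<Theta>. \<tau> a \<noteq> a}"
    using fin by (subst card_Un_disjoint[symmetric]) (auto intro: arg_cong[where f = card])
  moreover have "p dvd card \<Theta>" using card n k by simp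
  ultimately have "p dvd card {a \<in> \<Theta>. \<tau> a = a}" using moved by (simp add: dvd_add_left_iff)
  moreover have "(\<lambda>s. s mod int n) \<in> {a \<in> \<Theta>. \<tau> a = a}"
    using \<Theta>.one by (simp add: \<tau>_def mod_simps)
  ultimately have "{a \<in> \<Theta>. \<tau> a = a} \<noteq> {\<lambda>s. s mod int n}"
    using prime_gt_1_nat[OF p] by (metis card_1_singleton_iff One_nat_def nat_dvd_1_iff_1 less_irrefl)
  then obtain a where a: "a \<in> \<Theta>" "\<tau> a = a" "a \<noteq> (\<lambda>s. s mod int n)"
    using \<open>(\<lambda>s. s mod int n) \<in> {a \<in> \<Theta>. \<tau> a = a}\<close> by blast
  have "(\<tau> ^^ i) a = a" for i by (induction i) (auto simp: a(2))
  then have shift: "a s = (int i + a (s - int i)) mod int n" for s i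
    using \<tau>_pow[OF a(1)] by metis
  have a_trans: "[a s = s + a 0] (mod int n)" for s
  proof -
    \<comment> \<open>Undoing \<open>s mod n\<close> conjugations moves the argument \<open>s\<close> to \<open>0\<close>.\<close>
    have "int (nat (s mod int n)) = s mod int n" using n_pos by simp
    then have "a s = (s mod int n + a (s - s mod int n)) mod int n" using shift by metis
    moreover have "a (s - s mod int n) = a 0"
      by (rule \<Theta>_cong[OF a(1)]) (simp add: cong_def mod_simps)
    ultimately show ?thesis by (simp add: cong_def mod_simps)
  qed
  \<comment> \<open>If \<open>a\<close> were translation by zero, regularity would make it the neutral element.\<close>
  have "\<not> int n dvd a 0"
  proof
    assume "int n dvd a 0"
    then have "a 0 = 0" using \<Theta>_mod[OF a(1)] by (metis mod_0_imp_dvd mod_eq_0_iff_dvd)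
    then show False using \<Theta>_eqI[OF a(1) \<Theta>.one, of 0] a(3) by simp
  qed
  moreover have "[\<phi> (x + a 0) = \<phi> x] (mod int n)" for x
  proof -
    have "[a 0 + \<phi> (x + a 0) = \<theta> x (a 0)] (mod int n)" by (simp add: \<theta>_def)
    also have "\<theta> x (a 0) = a (\<theta> x 0)" by (simp add: \<Theta>_\<theta>[OF a(1)])
    also have "[a (\<theta> x 0) = \<theta> x 0 + a 0] (mod int n)" by (rule a_trans)
    also have "[\<theta> x 0 + a 0 = a 0 + \<phi> x] (mod int n)"
      by (simp add: \<theta>_def cong_def mod_simps add.commute)
    finally show ?thesis by (simp add: cong_add_lcancel)
  qed
  ultimately show ?thesis by blast
qed

end

section \<open>Solutions modulo the square of a prime are affine\<close>

lemma period_multiple: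
  fixes \<phi> :: "int \<Rightarrow> int"
  assumes "\<And>x. [\<phi> (x + c) = \<phi> x] (mod m)"
  shows "[\<phi> (x + k * c) = \<phi> x] (mod m)"
proof (induction k arbitrary: x rule: int_induct[where k = 0])
  case (step1 i)
  have "[\<phi> ((x + i * c) + c) = \<phi> x] (mod m)"
    using assms step1.IH by (rule cong_trans)
  then show ?case by (simp add: algebra_simps)
next
  case (step2 i)
  have "[\<phi> ((x + (i - 1) * c) + c) = \<phi> x] (mod m)"
    using step2.IH[of x] by (simp add: algebra_simps)
  then show ?case
    using assms cong_sym cong_trans by blast
qed simp

lemma period_gcd:
  fixes \<phi> :: "int \<Rightarrow> int"
  assumes "\<And>x. [\<phi> (x + c) = \<phi> x] (mod m)" and "\<And>x. [\<phi> (x + d) = \<phi> x] (mod m)"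
    and "gcd c d dvd q"
  shows "[\<phi> (x + q) = \<phi> x] (mod m)"
proof -
  obtain u v where "u * c + v * d = gcd c d" using bezout_int by blast
  moreover obtain w where "q = gcd c d * w" using assms(3) by blast
  ultimately have q: "q = (w * u) * c + (w * v) * d" by (metis (no_types) distrib_left mult.assoc mult.commute)
  have "[\<phi> (x + (w * u) * c + (w * v) * d) = \<phi> (x + (w * u) * c)] (mod m)"
    by (rule period_multiple[where \<phi> = \<phi>, OF assms(2)])
  also have "[\<phi> (x + (w * u) * c) = \<phi> x] (mod m)" by (rule period_multiple[where \<phi> = \<phi>, OF assms(1)])
  finally show ?thesis by (simp add: q add.assoc)
qed

text \<open>
  With \<open>period_gcd\<close>, this turns any period that is nonzero modulo \<open>p\<^sup>2\<close> into the period \<open>p\<close>.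
\<close>

lemma gcd_prime_square_dvd:
  assumes p: "prime p" and c: "\<not> int (p\<^sup>2) dvd c"
  shows "gcd c (int (p\<^sup>2)) dvd int p"
proof -
  have eq': "gcd c (int (p\<^sup>2)) = int (gcd (nat \<bar>c\<bar>) (p\<^sup>2))"
    unfolding gcd_int_def by (simp only: abs_of_nat nat_int)
  obtain j where j: "j \<le> 2" "gcd (nat \<bar>c\<bar>) (p\<^sup>2) = p ^ j"
    using gcd_dvd2[of "nat \<bar>c\<bar>" "p\<^sup>2"] unfolding divides_primepow_nat[OF p] by blast
  note eq = eq'[unfolded j(2)]
  have "int (p ^ j) dvd c" unfolding eq[symmetric] by (rule gcd_dvd1)
  then have "j \<noteq> 2" using c by blast
  then have "p ^ j dvd p ^ 1" using j(1) by (intro le_imp_power_dvd) simp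
  then show ?thesis unfolding eq by (simp only: int_dvd_int_iff power_one_right)
qed

text \<open>
  The function \<open>\<phi>\<close> has period \<open>p\<close> modulo \<open>p\<^sup>2\<close> and is constant modulo \<open>p\<close>, each time by
  \<open>exists_nontrivial_period\<close>. Consequently all shifts by values of \<open>\<phi>\<close> in the law may be replaced by
  shifts by \<open>u = \<phi> 0\<close>, and the law becomes the statement that \<open>\<phi> (x + u) - \<phi> x\<close> does not depend on
  \<open>x\<close>. This difference is a multiple \<open>p d\<close> of \<open>p\<close>, and \<open>t\<close> is \<open>d / u\<close> modulo \<open>p\<close>.
\<close>

theorem translation_law_prime_square:
  assumes p: "prime p" and law: "transitive_translation_law (p\<^sup>2) \<phi> x\<^sub>0"
  shows "\<exists>u t. coprime u (int p) \<and> t < p \<and>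
    (\<forall>i. [\<phi> (u * i) = u * (1 + int p * int t * i)] (mod int (p\<^sup>2)))"
proof -
  interpret transitive_translation_law "p\<^sup>2" \<phi> x\<^sub>0 by (rule law)
  have pp: "int (p\<^sup>2) = int p * int p" by (simp add: power2_eq_square)
  have mod_p: "[a = b] (mod int p)" if "[a = b] (mod int (p\<^sup>2))" for a b
    using that unfolding pp by (rule cong_modulus_mult)
  obtain c where c: "\<not> int (p\<^sup>2) dvd c" "\<And>x. [\<phi> (x + c) = \<phi> x] (mod int (p\<^sup>2))"
    using exists_nontrivial_period[OF p refl] by auto
  have period_p: "[\<phi> (x + int p) = \<phi> x] (mod int (p\<^sup>2))" for x
    by (rule period_gcd[where \<phi> = \<phi>, OF c(2) _ gcd_prime_square_dvd[OF p c(1)]])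
      (rule cong_arg, simp add: cong_def)
  have arg_p: "[\<phi> x = \<phi> y] (mod int (p\<^sup>2))" if xy: "[x = y] (mod int p)" for x y
  proof -
    obtain k where "y = x + int p * k" using xy by (auto simp: cong_iff_lin)
    then show ?thesis
      using cong_sym[OF period_multiple[where \<phi> = \<phi>, OF period_p, of x k]] by (simp add: mult.commute)
  qed
  have unit_p: "coprime (\<phi> x\<^sub>0) (int p)" using unit by (simp add: pp)
  \<comment> \<open>Because \<open>p\<close> is a period, \<open>\<phi>\<close> is well defined on residues modulo \<open>p\<close> and obeys the law there.\<close>
  interpret p: transitive_translation_law p \<phi> x\<^sub>0
    using prime_gt_0_nat[OF p] mod_p[OF arg_p] mod_p[OF law] unit_p
    by unfold_locales auto
  obtain c' where c': "\<not> int p dvd c'" "\<And>x. [\<phi> (x + c') = \<phi> x] (mod int p)"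
    using p.exists_nontrivial_period[OF p, of 1] by auto
  have "gcd c' (int p) = 1"
    using prime_imp_coprime[OF _ c'(1)] p by (simp add: coprime_iff_gcd_eq_1 gcd.commute)
  then have "[\<phi> (x + 1) = \<phi> x] (mod int p)" for x
    by (intro period_gcd[where \<phi> = \<phi>, OF c'(2) p.cong_arg]) (auto simp: cong_def)
  then have const: "[\<phi> x = \<phi> 0] (mod int p)" for x
    using period_multiple[of \<phi> 1 "int p" 0 x] by simp
  define u where "u = \<phi> 0"
  have u: "coprime u (int p)"
    using const[of x\<^sub>0] unit_p cong_imp_coprime unfolding u_def by blast
  have shift: "[\<phi> (x + \<phi> y) = \<phi> (x + u)] (mod int (p\<^sup>2))" for x y
    unfolding u_def by (intro arg_p cong_add const cong_refl)
  have "int p dvd \<phi> u - u" using const[of u] by (simp add: u_def cong_iff_dvd_diff)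
  then obtain d where d: "\<phi> u = u + int p * d" by (metis dvdE diff_add_cancel add.commute)
  have add_u: "[\<phi> (x + u) = \<phi> x + int p * d] (mod int (p\<^sup>2))" for x
  proof -
    have "[u + \<phi> (x + u) = \<phi> 0 + \<phi> (x + \<phi> 0)] (mod int (p\<^sup>2))" by (simp add: u_def)
    also have "[\<phi> 0 + \<phi> (x + \<phi> 0) = \<phi> x + \<phi> (0 + \<phi> x)] (mod int (p\<^sup>2))" by (rule law)
    also have "[\<phi> x + \<phi> (0 + \<phi> x) = \<phi> x + \<phi> (0 + u)] (mod int (p\<^sup>2))"
      by (intro cong_add cong_refl shift)
    also have "\<phi> x + \<phi> (0 + u) = u + (\<phi> x + int p * d)" by (simp add: d)
    finally show ?thesis by (simp only: cong_add_lcancel)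
  qed
  have lin: "[\<phi> (u * i) = u + int p * d * i] (mod int (p\<^sup>2))" for i
  proof -
    \<comment> \<open>A function with constant differences minus its linear part has period \<open>1\<close>.\<close>
    let ?\<psi> = "\<lambda>i. \<phi> (u * i) - int p * d * i"
    have "[?\<psi> (i + 1) = ?\<psi> i] (mod int (p\<^sup>2))" for i
      using cong_diff[OF add_u[of "u * i"] cong_refl[of "int p * d * (i + 1)"]]
      by (simp add: algebra_simps)
    then have "[?\<psi> (0 + i * 1) = ?\<psi> 0] (mod int (p\<^sup>2))"
      by (rule period_multiple[where \<phi> = ?\<psi>])
    then have "[?\<psi> i + int p * d * i = u + int p * d * i] (mod int (p\<^sup>2))"
      by (intro cong_add) (simp_all add: u_def)
    then show ?thesis by simp
  qed
  obtain v where v: "[u * v = 1] (mod int p)" using cong_solve_coprime_int[OF u] by blast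
  define t where "t = nat ((v * d) mod int p)"
  have t: "int t = (v * d) mod int p" using prime_gt_0_nat[OF p] by (simp add: t_def)
  have "[u * int t = u * (v * d)] (mod int p)" unfolding t by (intro cong_mult) auto
  also have "[u * (v * d) = d] (mod int p)"
    using cong_mult[OF v cong_refl[of d]] by (simp add: mult.assoc)
  finally obtain w where w: "d = u * int t + int p * w" by (auto simp: cong_iff_lin)
  have "[\<phi> (u * i) = u * (1 + int p * int t * i)] (mod int (p\<^sup>2))" for i
  proof -
    have "u + int p * d * i = u * (1 + int p * int t * i) + int (p\<^sup>2) * (w * i)"
      by (simp add: w power2_eq_square algebra_simps)
    then show ?thesis using lin[of i] by (simp add: cong_def)
  qed
  moreover have "t < p" using t prime_gt_0_nat[OF p]
    by (metis of_nat_0_less_iff of_nat_less_iff pos_mod_bound)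
  ultimately show ?thesis using u by blast
qed

section \<open>Cycle sets whose left multiplications are translations\<close>

text \<open>
  The bijection from \<open>\<int>/n\<int>\<close> to \<open>X\<close> is given as a map \<open>e\<close> on all integers whose fibres are the
  residue classes, which avoids choosing representatives when coordinates are added or rescaled.
\<close>

locale translation_coordinates =
  fixes n :: nat and \<phi> :: "int \<Rightarrow> int" and X :: "'a set" and m :: "'a \<Rightarrow> 'a \<Rightarrow> 'a"
    and e :: "int \<Rightarrow> 'a"
  assumes n_pos: "0 < n"
    and range_e: "range e = X"
    and e_eq_iff: "\<And>i j. e i = e j \<longleftrightarrow> [i = j] (mod int n)"
    and mult: "\<And>i j. m (e i) (e j) = e (j + \<phi> i)"
begin

lemma e_in [simp]: "e i \<in> X" using range_e by blast

lemma coordinate: "x \<in> X \<Longrightarrow> \<exists>i. x = e i" using range_e by blast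

lemma bij_betw_e: "bij_betw e {0..<int n} X"
proof (rule bij_betw_imageI)
  show "inj_on e {0..<int n}" by (rule inj_onI) (simp add: e_eq_iff cong_def)
  have "e i \<in> e ` {0..<int n}" for i
  proof -
    have "e i = e (i mod int n)" by (simp add: e_eq_iff)
    then show ?thesis using n_pos by auto
  qed
  then show "e ` {0..<int n} = X" using range_e by blast
qed

lemma finite_X: "finite X" and card_X: "card X = n"
  using bij_betw_finite[OF bij_betw_e] bij_betw_same_card[OF bij_betw_e] by auto

lemma \<phi>_cong: "[\<phi> i = \<phi> j] (mod int n)" if "[i = j] (mod int n)"
proof -
  have "e (0 + \<phi> i) = e (0 + \<phi> j)" using that by (metis e_eq_iff mult)
  then show ?thesis by (simp add: e_eq_iff)
qed

lemma bij_betw_mult: "x \<in> X \<Longrightarrow> bij_betw (m x) X X"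
proof -
  assume "x \<in> X"
  then obtain i where i: "x = e i" using coordinate by blast
  have "e j \<in> m x ` X" for j
    using mult[of i "j - \<phi> i"] by (auto simp: i intro!: image_eqI[of _ _ "e (j - \<phi> i)"])
  moreover have "m x y \<in> X" if "y \<in> X" for y
    using coordinate[OF that] by (auto simp: i mult)
  ultimately have "m x ` X = X" using coordinate by blast
  then show ?thesis using finite_X by (simp add: bij_betw_def eq_card_imp_inj_on)
qed

lemma cycle_set_iff_law:
  "cycle_set X m \<longleftrightarrow> (\<forall>x y. [\<phi> x + \<phi> (y + \<phi> x) = \<phi> y + \<phi> (x + \<phi> y)] (mod int n))"
proof -
  have "(\<forall>x\<in>X. \<forall>y\<in>X. \<forall>z\<in>X. m (m x y) (m x z) = m (m y x) (m y z)) \<longleftrightarrow>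
      (\<forall>i j k. m (m (e i) (e j)) (m (e i) (e k)) = m (m (e j) (e i)) (m (e j) (e k)))"
    unfolding range_e[symmetric] by blast
  also have "\<dots> \<longleftrightarrow> (\<forall>i j. [\<phi> i + \<phi> (j + \<phi> i) = \<phi> j + \<phi> (i + \<phi> j)] (mod int n))"
    by (simp add: mult e_eq_iff add.assoc cong_add_lcancel)
  finally show ?thesis
    using bij_betw_mult e_in unfolding cycle_set_def by blast
qed

lemma funpow_mult: "(m (e i) ^^ k) (e j) = e (j + int k * \<phi> i)"
  by (induction k) (simp_all add: mult algebra_simps)

text \<open>
  In the coordinate \<open>i\<close> with \<open>x = e (u i)\<close>, a translation by \<open>u c\<close> becomes a translation by \<open>c\<close>.
\<close>

lemma rescale:
  assumes u: "coprime u (int n)" and \<phi>': "\<And>i. [\<phi> (u * i) = u * \<phi>' i] (mod int n)"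
  shows "translation_coordinates n \<phi>' X m (\<lambda>i. e (u * i))"
proof
  show "range (\<lambda>i. e (u * i)) = X"
  proof
    obtain v where v: "[u * v = 1] (mod int n)" using cong_solve_coprime_int[OF u] by blast
    have "e i = e (u * (v * i))" for i
      using cong_sym[OF cong_mult[OF v cong_refl[of i]]] by (simp add: e_eq_iff mult.assoc)
    then show "X \<subseteq> range (\<lambda>i. e (u * i))" using coordinate by blast
  qed auto
  show "e (u * i) = e (u * j) \<longleftrightarrow> [i = j] (mod int n)" for i j
    using u by (simp add: e_eq_iff cong_mult_lcancel)
  have "[u * j + \<phi> (u * i) = u * (j + \<phi>' i)] (mod int n)" for i j
    using cong_add[OF cong_refl \<phi>'] by (simp add: distrib_left)
  then show "m (e (u * i)) (e (u * j)) = e (u * (j + \<phi>' i))" for i j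
    by (simp add: mult e_eq_iff)
qed (rule n_pos)

lemma transport:
  assumes h: "bij_betw h X Y" "\<And>x y. x \<in> X \<Longrightarrow> y \<in> X \<Longrightarrow> h (m x y) = m' (h x) (h y)"
  shows "translation_coordinates n \<phi> Y m' (\<lambda>i. h (e i))"
proof
  show "range (\<lambda>i. h (e i)) = Y" using h(1) range_e by (auto simp: bij_betw_def)
  show "h (e i) = h (e j) \<longleftrightarrow> [i = j] (mod int n)" for i j
    using inj_on_eq_iff[OF bij_betw_imp_inj_on[OF h(1)], of "e i" "e j"] by (simp add: e_eq_iff)
  show "m' (h (e i)) (h (e j)) = h (e (j + \<phi> i))" for i j
    using h(2)[of "e i" "e j"] by (simp add: mult)
qed (rule n_pos)

end

lemma translation_coordinates_iso:
  assumes "translation_coordinates n \<phi> X m e" and "translation_coordinates n \<phi> Y m' e'"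
  shows "cycle_set_iso X m Y m'"
proof -
  interpret X: translation_coordinates n \<phi> X m e by fact
  interpret Y: translation_coordinates n \<phi> Y m' e' by fact
  define h where "h = (\<lambda>x. e' (inv_into UNIV e x))"
  have h: "h (e i) = e' i" for i
    unfolding h_def Y.e_eq_iff X.e_eq_iff[symmetric] by (rule f_inv_into_f) simp
  have "bij_betw h X Y"
  proof (rule bij_betw_imageI)
    show "inj_on h X"
      using X.coordinate by (intro inj_onI) (metis h X.e_eq_iff Y.e_eq_iff)
    show "h ` X = Y" unfolding X.range_e[symmetric] Y.range_e[symmetric] by (auto simp: h[symmetric])
  qed
  moreover have "h (m x y) = m' (h x) (h y)" if "x \<in> X" "y \<in> X" for x y
    using X.coordinate[OF that(1)] X.coordinate[OF that(2)] by (auto simp: X.mult Y.mult h)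
  ultimately show ?thesis unfolding cycle_set_iso_def by blast
qed

section \<open>Coordinates from a cyclic permutation group\<close>

lemma carrier_BijGroup: "carrier (BijGroup X) = Bij X"
  by (simp add: BijGroup_def)

lemma BijGroup_mult: "f \<in> Bij X \<Longrightarrow> g \<in> Bij X \<Longrightarrow> f \<otimes>\<^bsub>BijGroup X\<^esub> g = compose X f g"
  by (simp add: BijGroup_def)

lemma BijGroup_pow_apply:
  assumes "f \<in> Bij X" and "y \<in> X"
  shows "(f [^]\<^bsub>BijGroup X\<^esub> (k::nat)) y = (f ^^ k) y"
  using assms(2)
proof (induction k arbitrary: y)
  case 0
  then show ?case by (simp add: nat_pow_def BijGroup_def)
next
  case (Suc k)
  interpret B: group "BijGroup X" by (rule group_BijGroup)
  have pow: "f [^]\<^bsub>BijGroup X\<^esub> k \<in> Bij X"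
    using B.nat_pow_closed[of f k] assms(1) by (simp only: carrier_BijGroup)
  have "f y \<in> X" using Bij_imp_funcset[OF assms(1)] Suc.prems by blast
  have "f [^]\<^bsub>BijGroup X\<^esub> Suc k = compose X (f [^]\<^bsub>BijGroup X\<^esub> k) f"
    unfolding B.nat_pow_Suc using pow assms(1) by (simp only: BijGroup_mult)
  then have "(f [^]\<^bsub>BijGroup X\<^esub> Suc k) y = (f [^]\<^bsub>BijGroup X\<^esub> k) (f y)"
    using Suc.prems by (simp only: compose_eq)
  also have "\<dots> = (f ^^ k) (f y)" by (rule Suc.IH) fact
  also have "\<dots> = (f ^^ Suc k) y" by (simp only: funpow_Suc_right o_apply)
  finally show ?case .
qed

lemma left_mult_in_Bij: "cycle_set X m \<Longrightarrow> x \<in> X \<Longrightarrow> left_mult X m x \<in> Bij X"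
  by (auto simp: cycle_set_def left_mult_def Bij_def cong: bij_betw_cong)

text \<open>
  As \<open>X\<close> is finite, so is the group, and nonnegative powers of a generator suffice. The generator is
  extended by the identity outside \<open>X\<close>, because elements of \<open>BijGroup X\<close> are undefined there whereas
  orbits are most convenient for permutations of the whole type.
\<close>

lemma cyclic_permutation_group_generator:
  assumes cs: "cycle_set X m" and fin: "finite X" and cyc: "cyclic_group (permutation_group X m)"
  shows "\<exists>g. g permutes X \<and> (\<forall>x\<in>X. \<exists>k. \<forall>y\<in>X. m x y = (g ^^ k) y)"
proof -
  interpret B: group "BijGroup X" by (rule group_BijGroup)
  let ?L = "left_mult X m ` X"
  let ?P = "permutation_group X m"
  have L: "?L \<subseteq> carrier (BijGroup X)"
    using left_mult_in_Bij[OF cs] by (auto simp: carrier_BijGroup)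
  interpret P: group ?P unfolding permutation_group_def by simp
  have P_sub: "carrier ?P \<subseteq> Bij X"
    using B.carrier_subgroup_generated_subset[of ?L] by (simp add: permutation_group_def carrier_BijGroup)
  have "Bij X \<subseteq> X \<rightarrow>\<^sub>E X" by (auto simp: Bij_def PiE_def dest: bij_betw_imp_funcset)
  then have "finite (Bij X)" using fin finite_PiE[of X "\<lambda>_. X"] finite_subset by blast
  then have fin_P: "finite (carrier ?P)" using P_sub finite_subset by blast
  obtain a where a: "a \<in> carrier ?P" "subgroup_generated ?P {a} = ?P"
    using cyc unfolding cyclic_group_def by blast
  have "carrier ?P = generate ?P {a}"
    using a by (metis carrier_subgroup_generated Int_insert_right_if1 Int_empty_right)
  also have "\<dots> = {a [^]\<^bsub>?P\<^esub> k |k. k \<in> (UNIV :: nat set)}"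
    by (rule P.generate_pow_on_finite_carrier[OF fin_P a(1)])
  finally have P_eq: "carrier ?P = {a [^]\<^bsub>BijGroup X\<^esub> k |k. k \<in> (UNIV :: nat set)}"
    by (simp add: permutation_group_def pow_subgroup_generated)
  have a_Bij: "a \<in> Bij X" using a(1) P_sub by blast
  define g where "g x = (if x \<in> X then a x else x)" for x
  have g: "g permutes X"
  proof (rule bij_imp_permutes)
    show "bij_betw g X X" using a_Bij by (auto simp: Bij_def g_def cong: bij_betw_cong)
  qed (simp add: g_def)
  have g_pow: "(g ^^ k) y = (a ^^ k) y" if "y \<in> X" for k y
  proof (induction k)
    case (Suc k)
    have "(g ^^ k) y \<in> X" using permutes_in_image[OF permutes_funpow[OF g]] that by blast
    then show ?case using Suc by (simp add: g_def)
  qed simp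
  have "\<exists>k. \<forall>y\<in>X. m x y = (g ^^ k) y" if x: "x \<in> X" for x
  proof -
    have "left_mult X m x \<in> carrier ?P"
      using B.subgroup_generated_subset_carrier_subset[OF L] x by (auto simp: permutation_group_def)
    then obtain k :: nat where k: "left_mult X m x = a [^]\<^bsub>BijGroup X\<^esub> k"
      using P_eq by blast
    have "m x y = (g ^^ k) y" if "y \<in> X" for y
      using fun_cong[OF k, of y] that BijGroup_pow_apply[OF a_Bij that] g_pow[OF that]
      by (simp add: left_mult_def)
    then show ?thesis by blast
  qed
  then show ?thesis using g by blast
qed

text \<open>
  The point \<open>x\<^sub>0\<close> provides a generator that is itself a left multiplication, so that the group
  generated by all of them equals the group generated by it.
\<close>

lemma cyclic_permutation_groupI:
  assumes cs: "cycle_set X m" and x\<^sub>0: "x\<^sub>0 \<in> X"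
    and pow: "\<And>x. x \<in> X \<Longrightarrow> \<exists>k. \<forall>y\<in>X. m x y = (m x\<^sub>0 ^^ k) y"
  shows "cyclic_group (permutation_group X m)"
proof -
  interpret B: group "BijGroup X" by (rule group_BijGroup)
  let ?L = "left_mult X m ` X" and ?a = "left_mult X m x\<^sub>0"
  have L: "?L \<subseteq> carrier (BijGroup X)"
    using left_mult_in_Bij[OF cs] by (auto simp: carrier_BijGroup)
  have a: "?a \<in> Bij X" by (rule left_mult_in_Bij[OF cs x\<^sub>0])
  then have a_car: "?a \<in> carrier (BijGroup X)" by (simp only: carrier_BijGroup)
  have "?L \<subseteq> generate (BijGroup X) {?a}"
  proof clarify
    fix x assume x: "x \<in> X"
    obtain k where k: "\<And>y. y \<in> X \<Longrightarrow> m x y = (m x\<^sub>0 ^^ k) y" using pow[OF x] by blast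
    have closed: "m x\<^sub>0 y \<in> X" if "y \<in> X" for y
      using cs x\<^sub>0 that by (auto simp: cycle_set_def bij_betw_def)
    have a_pow: "(?a ^^ j) y = (m x\<^sub>0 ^^ j) y \<and> (m x\<^sub>0 ^^ j) y \<in> X" if "y \<in> X" for j y
      by (induction j) (use that closed in \<open>auto simp: left_mult_def\<close>)
    have "left_mult X m x = ?a [^]\<^bsub>BijGroup X\<^esub> k"
    proof (rule extensionalityI[of _ X])
      show "?a [^]\<^bsub>BijGroup X\<^esub> k \<in> extensional X"
        using B.nat_pow_closed[OF a_car, of k] unfolding carrier_BijGroup by (rule Bij_imp_extensional)
      show "left_mult X m x y = (?a [^]\<^bsub>BijGroup X\<^esub> k) y" if "y \<in> X" for y
        using BijGroup_pow_apply[OF a that] a_pow[OF that] k[OF that] that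
        by (simp add: left_mult_def)
    qed (simp add: left_mult_def)
    also have "\<dots> = ?a [^]\<^bsub>BijGroup X\<^esub> int k" by (simp add: int_pow_int)
    also have "\<dots> \<in> generate (BijGroup X) {?a}" using B.generate_pow[OF a_car] by blast
    finally show "left_mult X m x \<in> generate (BijGroup X) {?a}" .
  qed
  then have "generate (BijGroup X) ?L \<subseteq> generate (BijGroup X) {?a}"
    using a_car by (intro B.generate_subgroup_incl B.generate_is_subgroup) auto
  moreover have "generate (BijGroup X) {?a} \<subseteq> generate (BijGroup X) ?L"
    using x\<^sub>0 by (intro B.mono_generate) auto
  ultimately have "permutation_group X m = subgroup_generated (BijGroup X) {?a}"
    unfolding permutation_group_def subgroup_generated_def using L a_car
    by (simp add: Int_absorb1)
  then show ?thesis by (simp add: B.cyclic_group_generated)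
qed

text \<open>
  Let \<open>g\<close> generate the permutation group. The \<open>g\<close>-orbit of a point and its complement are stable
  under all left multiplications, so indecomposability makes the orbit all of \<open>X\<close>. The coordinate
  of \<open>g\<^sup>i x\<^sub>0\<close> is \<open>i\<close>, and \<open>\<phi> i\<close> is the exponent of the left multiplication by this point.
\<close>

theorem indec_cyclic_coordinates:
  assumes X: "(X, m) \<in> indec_cyclic n" and n: "0 < n"
  shows "\<exists>\<phi> e. translation_coordinates n \<phi> X m e"
proof -
  have cs: "cycle_set X m" and card: "card X = n" and indec: "indecomposable X m"
    and cyc: "cyclic_group (permutation_group X m)"
    using X by (auto simp: indec_cyclic_def)
  have fin: "finite X" using card n card_ge_0_finite by blast
  have bij: "bij_betw (m x) X X" if "x \<in> X" for x using cs that by (simp add: cycle_set_def)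
  obtain g where g: "g permutes X" and pow: "\<And>x. x \<in> X \<Longrightarrow> \<exists>k. \<forall>y\<in>X. m x y = (g ^^ k) y"
    using cyclic_permutation_group_generator[OF cs fin cyc] by blast
  obtain x\<^sub>0 where x\<^sub>0: "x\<^sub>0 \<in> X" using cs by (auto simp: cycle_set_def)
  have self: "x\<^sub>0 \<in> orbit g x\<^sub>0"
    using g fin permutation_permutes permutation_self_in_orbit by metis
  have sub: "orbit g x\<^sub>0 \<subseteq> X" using permutes_orbit_subset[OF g x\<^sub>0] .
  have stable: "m x ` orbit g x\<^sub>0 \<subseteq> orbit g x\<^sub>0" if "x \<in> X" for x
    using pow[OF that] sub by (force intro: funpow_in_orbit)
  have co_stable: "m x ` (X - orbit g x\<^sub>0) \<subseteq> X - orbit g x\<^sub>0" if x: "x \<in> X" for x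
  proof -
    have inj: "inj_on (m x) X" and im: "m x ` X = X" using bij[OF x] by (auto simp: bij_betw_def)
    have "m x ` orbit g x\<^sub>0 = orbit g x\<^sub>0"
      using stable[OF x] inj_on_subset[OF inj sub] finite_subset[OF sub fin]
      by (intro endo_inj_surj)
    then show ?thesis using inj_on_image_set_diff[OF inj _ sub, of X] im by simp
  qed
  have orbit: "orbit g x\<^sub>0 = X"
  proof (rule ccontr)
    assume "orbit g x\<^sub>0 \<noteq> X"
    then have "X - orbit g x\<^sub>0 \<noteq> {}" using sub by blast
    moreover have "orbit g x\<^sub>0 \<union> (X - orbit g x\<^sub>0) = X" using sub by blast
    moreover have "orbit g x\<^sub>0 \<noteq> {}" "orbit g x\<^sub>0 \<inter> (X - orbit g x\<^sub>0) = {}" using self by auto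
    moreover have "\<forall>x\<in>X. m x ` orbit g x\<^sub>0 \<subseteq> orbit g x\<^sub>0 \<and>
        m x ` (X - orbit g x\<^sub>0) \<subseteq> X - orbit g x\<^sub>0"
      using stable co_stable by simp
    ultimately show False using indec unfolding indecomposable_def by metis
  qed
  define e where "e i = (g ^^ nat (i mod int n)) x\<^sub>0" for i
  have nat_mod: "int (nat (i mod int n)) = i mod int n" for i using n by simp
  have pow_eq: "(g ^^ i) x\<^sub>0 = (g ^^ j) x\<^sub>0 \<longleftrightarrow> [int i = int j] (mod int n)" for i j
    using funpow_eq_iff_cong_card_orbit[OF self, of i j] by (simp add: orbit card cong_int_iff)
  have e_nat: "e (int i) = (g ^^ i) x\<^sub>0" for i unfolding e_def pow_eq nat_mod by simp
  have e_in: "e i \<in> X" for i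
    unfolding e_def by (metis orbit self funpow_in_orbit)
  define \<phi> where "\<phi> i = int (SOME k. \<forall>y\<in>X. m (e i) y = (g ^^ k) y)" for i
  have \<phi>: "m (e i) y = (g ^^ nat (\<phi> i)) y" if "y \<in> X" for i y
    using someI_ex[OF pow[OF e_in[of i]]] that by (simp add: \<phi>_def)
  have "translation_coordinates n \<phi> X m e"
  proof
    show "range e = X"
    proof (intro equalityI subsetI)
      fix x assume "x \<in> X"
      then obtain k where "x = (g ^^ k) x\<^sub>0" by (auto simp: orbit[symmetric] orbit_altdef)
      then show "x \<in> range e" by (metis e_nat rangeI)
    qed (use e_in in auto)
    show "e i = e j \<longleftrightarrow> [i = j] (mod int n)" for i j
      unfolding e_def pow_eq nat_mod by simp
    show "m (e i) (e j) = e (j + \<phi> i)" for i j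
    proof -
      have \<phi>_nat: "int (nat (\<phi> i)) = \<phi> i" by (simp add: \<phi>_def)
      have "m (e i) (e j) = (g ^^ (nat (\<phi> i) + nat (j mod int n))) x\<^sub>0"
        unfolding \<phi>[OF e_in] by (simp add: e_def funpow_add)
      also have "\<dots> = (g ^^ nat ((j + \<phi> i) mod int n)) x\<^sub>0"
        unfolding pow_eq of_nat_add nat_mod \<phi>_nat by (simp add: cong_def mod_simps add.commute)
      finally show ?thesis by (simp add: e_def)
    qed
  qed (rule n)
  then show ?thesis by blast
qed

text \<open>
  Otherwise all translations would be by multiples of \<open>p\<close>, and the points with coordinate divisible by
  \<open>p\<close> would be separated from the others.
\<close>

lemma (in translation_coordinates) indecomposable_imp_unit:
  assumes p: "prime p" and n: "n = p ^ k" "0 < k" and indec: "indecomposable X m"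
  shows "\<exists>i. coprime (\<phi> i) (int n)"
proof (rule ccontr)
  assume "\<nexists>i. coprime (\<phi> i) (int n)"
  then have dvd: "int p dvd \<phi> i" for i
    using p n by (metis coprime_commute coprime_power_left_iff of_nat_power prime_imp_coprime
        prime_nat_int_transfer)
  have p_dvd_n: "int p dvd int n" using n by simp
  have e_dvd: "int p dvd i \<longleftrightarrow> int p dvd j" if "e i = e j" for i j
    using that unfolding e_eq_iff by (meson cong_dvd_iff cong_dvd_modulus p_dvd_n)
  let ?Y = "e ` {i. int p dvd i}" and ?Z = "e ` {i. \<not> int p dvd i}"
  have "\<not> int p dvd 1" using p by (metis not_prime_unit prime_nat_int_transfer)
  then have "e 0 \<in> ?Y" "e 1 \<in> ?Z" by auto
  then have "?Y \<noteq> {}" "?Z \<noteq> {}" by blast+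
  moreover have "?Y \<inter> ?Z = {}" using e_dvd by blast
  moreover have "?Y \<union> ?Z = X" unfolding range_e[symmetric] by auto
  moreover have "m x ` ?Y \<subseteq> ?Y" "m x ` ?Z \<subseteq> ?Z" if x: "x \<in> X" for x
  proof -
    obtain i where i: "x = e i" using coordinate[OF x] by blast
    show "m x ` ?Y \<subseteq> ?Y" "m x ` ?Z \<subseteq> ?Z"
      by (auto simp: i mult dvd_add_left_iff[OF dvd] intro!: imageI)
  qed
  ultimately show False using indec unfolding indecomposable_def by metis
qed

theorem indec_cyclic_prime_square_coordinates:
  assumes p: "prime p" and X: "(X, m) \<in> indec_cyclic (p\<^sup>2)"
  shows "\<exists>t e. t < p \<and> translation_coordinates (p\<^sup>2) (\<lambda>i. 1 + int p * int t * i) X m e"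
proof -
  have "0 < p\<^sup>2" using prime_gt_0_nat[OF p] by simp
  then obtain \<phi> e where "translation_coordinates (p\<^sup>2) \<phi> X m e"
    using indec_cyclic_coordinates[OF X] by blast
  then interpret translation_coordinates "p\<^sup>2" \<phi> X m e .
  have "indecomposable X m" and cs: "cycle_set X m" using X by (auto simp: indec_cyclic_def)
  then obtain i where "coprime (\<phi> i) (int (p\<^sup>2))"
    using indecomposable_imp_unit[OF p refl] by auto
  then have "transitive_translation_law (p\<^sup>2) \<phi> i"
    using n_pos \<phi>_cong cs[unfolded cycle_set_iff_law] by unfold_locales auto
  then obtain u t where ut: "coprime u (int p)" "t < p"
      "\<And>i. [\<phi> (u * i) = u * (1 + int p * int t * i)] (mod int (p\<^sup>2))"
    using translation_law_prime_square[OF p] by blast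
  have "coprime u (int (p\<^sup>2))" using ut(1) by simp
  then show ?thesis using rescale[OF _ ut(3)] ut(2) by blast
qed

section \<open>Levels one and two as equations\<close>

lemma card_eq_1_image_iff:
  "card (f ` A) = 1 \<longleftrightarrow> A \<noteq> {} \<and> (\<forall>a\<in>A. \<forall>b\<in>A. f a = f b)"
proof
  assume "card (f ` A) = 1"
  then obtain c where c: "f ` A = {c}" by (auto simp: card_1_singleton_iff)
  have "f a = c" if "a \<in> A" for a using imageI[OF that, of f] c by simp
  then show "A \<noteq> {} \<and> (\<forall>a\<in>A. \<forall>b\<in>A. f a = f b)" using c by auto
next
  assume *: "A \<noteq> {} \<and> (\<forall>a\<in>A. \<forall>b\<in>A. f a = f b)"
  then obtain a where a: "a \<in> A" by blast
  have "f b = f a" if "b \<in> A" for b using bspec[OF bspec[OF conjunct2[OF *] that] a] .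
  then have "f ` A = {f a}" using a by blast
  then show "card (f ` A) = 1" by simp
qed

lemma left_mult_eq_iff: "left_mult X m x = left_mult X m x' \<longleftrightarrow> (\<forall>y\<in>X. m x y = m x' y)"
  by (auto simp: left_mult_def fun_eq_iff restrict_def)

lemma left_mult_retraction_rep:
  "x \<in> X \<Longrightarrow> left_mult X m (retraction_rep X m (left_mult X m x)) = left_mult X m x"
  by (simp add: retraction_rep_def f_inv_into_f)

lemma card_fst_retract: "card (fst (retract (X, m))) = card (left_mult X m ` X)"
  by (simp add: retraction_carrier_def retraction_rep_def card_image inj_on_inv_into)

lemma retraction_card_0: "retraction_card 0 X m = card X"
  by (simp add: retraction_card_def)

lemma retraction_card_1_iff:
  "retraction_card 1 X m = 1 \<longleftrightarrow> X \<noteq> {} \<and> (\<forall>x\<in>X. \<forall>x'\<in>X. \<forall>y\<in>X. m x y = m x' y)"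
  unfolding retraction_card_def
  by (simp add: card_fst_retract card_eq_1_image_iff[unfolded One_nat_def] left_mult_eq_iff del: retract.simps)

text \<open>
  The point of the second retraction that belongs to \<open>x \<in> X\<close> is determined by the left multiplication
  of \<open>\<sigma>\<^sub>x\<close> in the first retraction, \<open>\<sigma>\<^sub>y \<mapsto> \<sigma>\<^sub>x\<^sub>\<cdot>\<^sub>y\<close>. Only one point is left if this map is the
  same for all \<open>x\<close>.
\<close>

lemma retraction_card_2_iff:
  assumes cs: "cycle_set X m"
  shows "retraction_card 2 X m = 1 \<longleftrightarrow>
    (\<forall>x\<in>X. \<forall>x'\<in>X. \<forall>y\<in>X. \<forall>z\<in>X. m (m x y) z = m (m x' y) z)"
proof -
  let ?r = "\<lambda>x. retraction_rep X m (left_mult X m x)"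
  let ?X = "fst (retract (X, m))" and ?m = "snd (retract (X, m))"
  have X': "?X = ?r ` X" by (simp add: retraction_carrier_def image_image)
  have r_eq: "?r x = ?r y \<longleftrightarrow> left_mult X m x = left_mult X m y" if "x \<in> X" "y \<in> X" for x y
    using left_mult_retraction_rep that by metis
  have closed: "m x y \<in> X" if "x \<in> X" "y \<in> X" for x y
    using cs that by (auto simp: cycle_set_def bij_betw_def)
  have m': "?m (?r x) (?r y) = ?r (m x y)" if "x \<in> X" "y \<in> X" for x y
    using that by (simp add: left_mult_retraction_rep retraction_mult_left_mult[OF cs])
  have "X \<noteq> {}" using cs by (simp add: cycle_set_def)
  have "retraction_card 2 X m = card (fst (retract (?X, ?m)))"
    by (simp add: retraction_card_def numeral_2_eq_2 del: retract.simps)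
  then have "retraction_card 2 X m = 1 \<longleftrightarrow>
      ?X \<noteq> {} \<and> (\<forall>x\<in>?X. \<forall>x'\<in>?X. \<forall>y\<in>?X. ?m x y = ?m x' y)"
    by (simp only: card_fst_retract card_eq_1_image_iff left_mult_eq_iff)
  also have "\<dots> \<longleftrightarrow> (\<forall>x\<in>X. \<forall>x'\<in>X. \<forall>y\<in>X. ?m (?r x) (?r y) = ?m (?r x') (?r y))"
    using \<open>X \<noteq> {}\<close> unfolding X' by blast
  also have "\<dots> \<longleftrightarrow> (\<forall>x\<in>X. \<forall>x'\<in>X. \<forall>y\<in>X. ?r (m x y) = ?r (m x' y))"
    using m' by simp
  also have "\<dots> \<longleftrightarrow> (\<forall>x\<in>X. \<forall>x'\<in>X. \<forall>y\<in>X. left_mult X m (m x y) = left_mult X m (m x' y))"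
    using r_eq closed by simp
  finally show ?thesis by (simp only: left_mult_eq_iff)
qed

section \<open>The cycle sets with affine translation function\<close>

text \<open>
  The normal form of the classification, up to the choice of coordinates.
\<close>

locale affine_coordinates =
  translation_coordinates "p\<^sup>2" "\<lambda>i. 1 + int p * int t * i" X m e
  for p t :: nat and X :: "'a set" and m and e +
  assumes p: "prime p" and t: "t < p"
begin

lemma square: "int (p\<^sup>2) = int p * int p"
  by (simp add: power2_eq_square)

lemma same_action_iff:
  "m (e i) (e k) = m (e j) (e k) \<longleftrightarrow> int p dvd int t * (i - j)"
proof -
  have "m (e i) (e k) = m (e j) (e k) \<longleftrightarrow> int (p\<^sup>2) dvd int p * (int t * (i - j))"
    by (simp add: mult e_eq_iff cong_iff_dvd_diff algebra_simps)
  also have "\<dots> \<longleftrightarrow> int p dvd int t * (i - j)"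
    unfolding square using p by (subst dvd_mult_cancel_left) auto
  finally show ?thesis .
qed

lemma cycle_set: "cycle_set X m"
  unfolding cycle_set_iff_law
proof (intro allI)
  fix x y :: int
  have "1 + int p * int t * x + (1 + int p * int t * (y + (1 + int p * int t * x))) -
      (1 + int p * int t * y + (1 + int p * int t * (x + (1 + int p * int t * y)))) =
      int (p\<^sup>2) * (int t * int t * (x - y))"
    by (simp add: power2_eq_square algebra_simps)
  then show "[1 + int p * int t * x + (1 + int p * int t * (y + (1 + int p * int t * x))) =
      1 + int p * int t * y + (1 + int p * int t * (x + (1 + int p * int t * y)))] (mod int (p\<^sup>2))"
    unfolding cong_iff_dvd_diff by (metis dvd_triv_left)
qed

lemma indecomposable: "indecomposable X m"
proof -
  have "X \<subseteq> Y" if Y: "Y \<subseteq> X" "Y \<noteq> {}" and stable: "\<forall>x\<in>X. m x ` Y \<subseteq> Y" for Y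
  proof
    fix x assume "x \<in> X"
    then obtain i where i: "x = e i" using coordinate by blast
    obtain j where j: "e j \<in> Y" using Y coordinate by blast
    have "(m (e 0) ^^ k) (e j) \<in> Y" for k
    proof (induction k)
      case (Suc k)
      then show ?case using bspec[OF stable e_in[of 0]] by auto
    qed (use j in simp)
    then have "e (j + int k) \<in> Y" for k by (simp add: funpow_mult)
    moreover define k where "k = nat ((i - j) mod int (p\<^sup>2))"
    moreover have "int k = (i - j) mod int (p\<^sup>2)" using n_pos by (simp add: k_def)
    then have "e (j + int k) = e i" by (simp add: e_eq_iff cong_def mod_simps)
    ultimately show "x \<in> Y" using i by metis
  qed
  then show ?thesis unfolding indecomposable_def by blast
qed

text \<open>
  The left multiplication by \<open>e 0\<close> is the translation by \<open>1\<close>, which generates all translations.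
\<close>

lemma cyclic: "cyclic_group (permutation_group X m)"
proof (rule cyclic_permutation_groupI[OF cycle_set e_in[of 0]])
  fix x assume "x \<in> X"
  then obtain i where i: "x = e i" using coordinate by blast
  define k where "k = nat ((1 + int p * int t * i) mod int (p\<^sup>2))"
  have k: "int k = (1 + int p * int t * i) mod int (p\<^sup>2)" using n_pos by (simp add: k_def)
  have "m x (e j) = (m (e 0) ^^ k) (e j)" for j
    by (simp add: i mult funpow_mult k e_eq_iff cong_def mod_simps)
  then show "\<exists>k. \<forall>y\<in>X. m x y = (m (e 0) ^^ k) y" using coordinate by blast
qed

lemma in_indec_cyclic: "(X, m) \<in> indec_cyclic (p\<^sup>2)"
  using cycle_set card_X indecomposable cyclic by (simp add: indec_cyclic_def)

text \<open>
  In coordinates the diagonal map is \<open>i \<mapsto> 1 + (1 + p t) i\<close>, and \<open>1 + p t\<close> is a unit.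
\<close>

lemma non_degenerate: "non_degenerate X m"
proof -
  let ?c = "1 + int p * int t"
  have diag: "m (e i) (e i) = e (1 + ?c * i)" for i by (simp add: mult algebra_simps)
  have "coprime ?c (int p)"
    by (metis coprime_1_left coprime_iff_gcd_eq_1 gcd_add_mult gcd.commute add.commute mult.commute)
  then have c: "coprime ?c (int (p\<^sup>2))" by simp
  have "inj_on (\<lambda>x. m x x) X"
  proof (rule inj_onI)
    fix x y assume "x \<in> X" "y \<in> X" and eq: "m x x = m y y"
    then obtain i j where ij: "x = e i" "y = e j" using coordinate by blast
    have "[1 + ?c * i = 1 + ?c * j] (mod int (p\<^sup>2))" using eq unfolding ij diag e_eq_iff .
    then show "x = y" unfolding ij e_eq_iff cong_add_lcancel cong_mult_lcancel[OF c] .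
  qed
  moreover have "(\<lambda>x. m x x) ` X \<subseteq> X" using bij_betwE[OF bij_betw_mult] by blast
  ultimately show ?thesis
    unfolding non_degenerate_def by (simp add: bij_betw_def endo_inj_surj finite_X)
qed

text \<open>
  The left multiplication by \<open>e i\<close> is determined by \<open>t i\<close> modulo \<open>p\<close>. Hence all of them agree
  precisely if \<open>t = 0\<close>. On coordinates modulo \<open>p\<close> every left multiplication is the translation by \<open>1\<close>,
  so the second retraction is always a single point.
\<close>

lemma multipermutational_level_1_iff: "multipermutational_level X m 1 \<longleftrightarrow> t = 0"
  and multipermutational_level_2_iff: "multipermutational_level X m 2 \<longleftrightarrow> t \<noteq> 0"
proof -
  have card_0: "retraction_card 0 X m \<noteq> 1"
    using prime_gt_1_nat[OF p] by (simp add: retraction_card_0 card_X)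
  have card_1: "retraction_card 1 X m = 1 \<longleftrightarrow> t = 0"
  proof -
    have "retraction_card 1 X m = 1 \<longleftrightarrow> (\<forall>i j. int p dvd int t * (i - j))"
      unfolding retraction_card_1_iff range_e[symmetric] by (simp add: same_action_iff)
    also have "\<dots> \<longleftrightarrow> int p dvd int t"
      by (metis diff_zero dvd_mult2 mult.right_neutral)
    also have "\<dots> \<longleftrightarrow> t = 0" using t by (auto dest: dvd_imp_le)
    finally show ?thesis .
  qed
  have "m (m (e i) (e j)) (e k) = m (m (e i') (e j)) (e k)" for i i' j k
  proof -
    have "int t * ((j + (1 + int p * int t * i)) - (j + (1 + int p * int t * i'))) =
        int p * (int t * int t * (i - i'))"
      by (simp add: algebra_simps)
    then show ?thesis unfolding mult[of i j] mult[of i' j] same_action_iff by simp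
  qed
  then have card_2: "retraction_card 2 X m = 1"
    unfolding retraction_card_2_iff[OF cycle_set] using coordinate by metis
  show "multipermutational_level X m 1 \<longleftrightarrow> t = 0"
    using non_degenerate card_0 card_1 by (simp add: multipermutational_level_def)
  have "(\<forall>j<2. retraction_card j X m \<noteq> 1) \<longleftrightarrow> retraction_card 1 X m \<noteq> 1"
    using card_0 less_2_cases_iff by auto
  then show "multipermutational_level X m 2 \<longleftrightarrow> t \<noteq> 0"
    using non_degenerate card_1 card_2 by (simp add: multipermutational_level_def)
qed

lemma in_indec_cyclic_level_iff:
  "(X, m) \<in> indec_cyclic_level (p\<^sup>2) 1 \<longleftrightarrow> t = 0"
  "(X, m) \<in> indec_cyclic_level (p\<^sup>2) 2 \<longleftrightarrow> t \<noteq> 0"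
  using in_indec_cyclic multipermutational_level_1_iff multipermutational_level_2_iff
  by (simp_all add: indec_cyclic_level_def)

end

text \<open>
  Let \<open>h\<close> be the change of coordinates from the second system to the first one. Expressing
  left multiplication by \<open>e' 0\<close> in both systems shows that \<open>h\<close> is affine of slope
  \<open>u = 1 + p t (h 0)\<close>, and left multiplication by \<open>e' 1\<close> gives \<open>p t' u = p t u\<close> modulo \<open>p\<^sup>2\<close>;
  here \<open>u = 1\<close> modulo \<open>p\<close>.
\<close>

lemma affine_coordinates_unique:
  assumes "affine_coordinates p t X m e" and "affine_coordinates p t' X m e'"
  shows "t = t'"
proof -
  interpret A: affine_coordinates p t X m e by fact
  interpret B: affine_coordinates p t' X m e' by fact
  have "\<exists>j. e' i = e j" for i using A.coordinate[OF B.e_in] .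
  then obtain h where h: "e' i = e (h i)" for i by metis
  have h_mult: "[h (j + (1 + int p * int t' * i)) = h j + (1 + int p * int t * h i)] (mod int (p\<^sup>2))" for i j
    using B.mult[of i j] by (simp only: h A.mult A.e_eq_iff cong_sym_eq)
  have mod_p: "[a = b] (mod int p)" if "[a = b] (mod int (p\<^sup>2))" for a b
    using that unfolding A.square by (rule cong_modulus_mult)
  define u where "u = 1 + int p * int t * h 0"
  have step: "[h (j + 1) = h j + u] (mod int (p\<^sup>2))" for j
    using h_mult[of j 0] by (simp add: u_def)
  have lin: "[h i = h 0 + i * u] (mod int (p\<^sup>2))" for i
  proof -
    let ?\<psi> = "\<lambda>i. h i - i * u"
    have "[?\<psi> (i + 1) = ?\<psi> i] (mod int (p\<^sup>2))" for i
      using cong_diff[OF step[of i] cong_refl[of "(i + 1) * u"]] by (simp add: algebra_simps)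
    then have "[?\<psi> (0 + i * 1) = ?\<psi> 0] (mod int (p\<^sup>2))" by (rule period_multiple[where \<phi> = ?\<psi>])
    then have "[?\<psi> i + i * u = h 0 + i * u] (mod int (p\<^sup>2))" by (intro cong_add) simp_all
    then show ?thesis by simp
  qed
  have "[h 0 + (1 + int p * int t') * u = h (1 + int p * int t')] (mod int (p\<^sup>2))"
    by (rule cong_sym[OF lin])
  also have "[h (1 + int p * int t') = h 0 + (1 + int p * int t * h 1)] (mod int (p\<^sup>2))"
    using h_mult[of 0 1] by simp
  finally have "[(1 + int p * int t') * u = 1 + int p * int t * h 1] (mod int (p\<^sup>2))"
    by (simp only: cong_add_lcancel)
  then have "int p * int p dvd int p * (int t' * u + int t * h 0 - int t * h 1)"
    unfolding A.square cong_iff_dvd_diff by (simp add: u_def algebra_simps)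
  then have "int p dvd int t' * u + int t * h 0 - int t * h 1"
    using A.p by (subst (asm) dvd_mult_cancel_left) auto
  then have "[int t' * u + int t * h 0 = int t * h 1] (mod int p)"
    by (simp add: cong_iff_dvd_diff)
  also have "[int t * h 1 = int t * (h 0 + 1 * u)] (mod int p)"
    by (intro cong_mult cong_refl mod_p lin)
  finally have "[int t' * u + int t * h 0 = int t * u + int t * h 0] (mod int p)"
    by (simp add: algebra_simps)
  then have tu: "[int t' * u = int t * u] (mod int p)" by (simp only: cong_add_rcancel)
  have u1: "[u = 1] (mod int p)" by (simp add: u_def cong_iff_dvd_diff)
  have "[int t' = int t] (mod int p)"
    using cong_trans[OF cong_sym[OF cong_mult[OF cong_refl u1]] cong_trans[OF tu cong_mult[OF cong_refl u1]]]
    by simp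
  then show ?thesis using A.t B.t by (simp add: cong_int_iff cong_def)
qed

section \<open>The standard models\<close>

lemma standard_cycle_apply:
  assumes "j < p\<^sup>2"
  shows "standard_cycle p j = (j + 1) mod p\<^sup>2"
proof -
  let ?cs = "[0..<p\<^sup>2]"
  have "standard_cycle p j = map (standard_cycle p ^^ 1) ?cs ! j" using assms by simp
  also have "\<dots> = rotate 1 ?cs ! j"
    unfolding standard_cycle_def by (subst cyclic_rotation) simp_all
  also have "\<dots> = ?cs ! ((1 + j) mod p\<^sup>2)" using assms by (subst nth_rotate) simp_all
  also have "(1 + j) mod p\<^sup>2 < p\<^sup>2" using assms by (intro mod_less_divisor) linarith
  then have "?cs ! ((1 + j) mod p\<^sup>2) = (j + 1) mod p\<^sup>2" by (simp only: nth_upt add_0 add.commute)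
  finally show ?thesis .
qed

lemma standard_mult_apply:
  assumes "j < p\<^sup>2"
  shows "standard_mult p f i j = (j + (1 + p * f i)) mod p\<^sup>2"
proof -
  have "0 < p\<^sup>2" using assms by linarith
  have "(standard_cycle p ^^ k) j = (j + k) mod p\<^sup>2" for k
  proof (induction k)
    case (Suc k)
    then show ?case using \<open>0 < p\<^sup>2\<close> by (simp add: standard_cycle_apply mod_Suc_eq)
  qed (use assms in simp)
  then show ?thesis unfolding standard_mult_def .
qed

theorem standard_affine_coordinates:
  assumes p: "prime p" and t: "t < p"
  shows "affine_coordinates p t {0..<p\<^sup>2} (standard_mult p (residue_scale p t))
    (\<lambda>i. nat (i mod int (p\<^sup>2)))"
proof
  have pos: "0 < p\<^sup>2" using prime_gt_0_nat[OF p] by simp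
  show "0 < p\<^sup>2" "prime p" "t < p" by fact+
  let ?e = "\<lambda>i. nat (i mod int (p\<^sup>2))"
  have int_e: "int (?e i) = i mod int (p\<^sup>2)" for i using pos by simp
  have e_lt: "?e i < p\<^sup>2" for i
    using pos int_e[of i] by (metis of_nat_0_less_iff of_nat_less_iff pos_mod_bound)
  show "range ?e = {0..<p\<^sup>2}"
  proof (intro equalityI subsetI)
    fix x assume "x \<in> {0..<p\<^sup>2}"
    then have "x = ?e (int x)" by (simp flip: of_nat_mod of_nat_power)
    then show "x \<in> range ?e" by blast
  qed (use e_lt in auto)
  show "?e i = ?e j \<longleftrightarrow> [i = j] (mod int (p\<^sup>2))" for i j
    unfolding cong_def by (metis int_e)
  show "standard_mult p (residue_scale p t) (?e i) (?e j) = ?e (j + (1 + int p * int t * i))" for i j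
  proof -
    have "int p * ((?e i * t) mod p) = (int p * (int (?e i) * int t)) mod int (p\<^sup>2)"
      by (simp add: power2_eq_square zmod_int flip: mult_mod_right)
    also have "\<dots> = (int p * (i * int t)) mod int (p\<^sup>2)"
      unfolding int_e cong_def[symmetric] by (intro cong_mult cong_refl) (simp add: cong_def)
    finally have scale: "[int p * ((?e i * t) mod p) = int p * int t * i] (mod int (p\<^sup>2))"
      by (simp add: cong_def ac_simps)
    have "int (standard_mult p (residue_scale p t) (?e i) (?e j)) =
        (int (?e j) + (1 + int p * ((?e i * t) mod p))) mod int (p\<^sup>2)"
      unfolding standard_mult_apply[OF e_lt] residue_scale_def
      by (simp only: zmod_int of_nat_add of_nat_mult of_nat_1)
    also have "\<dots> = (j + (1 + int p * int t * i)) mod int (p\<^sup>2)"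
      unfolding cong_def[symmetric] by (intro cong_add scale cong_refl)
        (simp only: int_e cong_def mod_mod_trivial)
    finally show ?thesis by (metis int_e nat_int)
  qed
qed

lemma bij_betw_residue_scale:
  assumes p: "prime p" and t: "t \<in> {1..<p}"
  shows "bij_betw (residue_scale p t) {0..<p} {0..<p}"
proof -
  have "coprime t p" using p t by (metis atLeastLessThan_iff coprime_commute dvd_imp_le leD not_one_le_zero gr0I prime_imp_coprime)
  then have "inj_on (residue_scale p t) {0..<p}"
    by (intro inj_onI) (auto simp: residue_scale_def cong_mult_rcancel_nat simp flip: cong_def, auto simp: cong_def)
  moreover have "residue_scale p t ` {0..<p} \<subseteq> {0..<p}"
    using t by (auto simp: residue_scale_def)
  ultimately show ?thesis by (simp add: bij_betw_def endo_inj_surj)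
qed

section \<open>Counting isomorphism classes\<close>

text \<open>
  Stated for a subset \<open>S\<close> of the domain of the equivalence relation, so that the classes of \<open>S // R\<close> may
  contain elements outside \<open>S\<close>; only representatives have to be controlled.
\<close>

lemma card_quotient_by_representatives:
  assumes eq: "equiv A R" and S: "S \<subseteq> A" and N: "\<And>t. t \<in> T \<Longrightarrow> N t \<in> S"
    and complete: "\<And>x. x \<in> S \<Longrightarrow> \<exists>t\<in>T. (x, N t) \<in> R"
    and irredundant: "\<And>t t'. t \<in> T \<Longrightarrow> t' \<in> T \<Longrightarrow> (N t, N t') \<in> R \<Longrightarrow> t = t'"
  shows "card (S // R) = card T"
proof -
  have "bij_betw (\<lambda>t. R `` {N t}) T (S // R)"
  proof (rule bij_betw_imageI)
    show "inj_on (\<lambda>t. R `` {N t}) T"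
      using irredundant N S by (intro inj_onI) (meson eq eq_equiv_class in_mono)
    show "(\<lambda>t. R `` {N t}) ` T = S // R"
    proof (intro equalityI subsetI)
      fix c assume "c \<in> S // R"
      then obtain x where x: "x \<in> S" "c = R `` {x}" by (rule quotientE)
      then show "c \<in> (\<lambda>t. R `` {N t}) ` T" using complete[OF x(1)] equiv_class_eq[OF eq] by blast
    qed (use N in \<open>auto intro: quotientI\<close>)
  qed
  then show ?thesis by (simp add: bij_betw_same_card)
qed

text \<open>
  Every cycle set under consideration has affine coordinates for exactly one \<open>t < p\<close>, and membership
  in each of the three families is a condition on \<open>t\<close>: none, \<open>t \<noteq> 0\<close> and \<open>t = 0\<close>. The
  classes are therefore counted by the values of \<open>t\<close>. The set \<open>A\<close> serves to transport the standard
  models to the given type, so that each value of \<open>t\<close> occurs there.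
\<close>

theorem theorem14:
  fixes p :: nat
  assumes "prime p"
    and "\<exists>A :: 'a set. card A = p\<^sup>2"
  shows
    "card ((indec_cyclic (p\<^sup>2) :: ('a set \<times> ('a \<Rightarrow> 'a \<Rightarrow> 'a)) set) // iso_rel) = p
   \<and> card ((indec_cyclic_level (p\<^sup>2) 2 :: ('a set \<times> ('a \<Rightarrow> 'a \<Rightarrow> 'a)) set) // iso_rel) = p - 1
   \<and> card ((indec_cyclic_level (p\<^sup>2) 1 :: ('a set \<times> ('a \<Rightarrow> 'a \<Rightarrow> 'a)) set) // iso_rel) = 1
   \<and> (\<forall>t\<in>{1..<p}. bij_betw (residue_scale p t) {0..<p} {0..<p}
        \<and> ({0..<p\<^sup>2}, standard_mult p (residue_scale p t)) \<in> indec_cyclic_level (p\<^sup>2) 2)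
   \<and> (\<forall>(X :: 'a set, m) \<in> indec_cyclic_level (p\<^sup>2) 2.
        \<exists>!t. t \<in> {1..<p} \<and>
          cycle_set_iso X m {0..<p\<^sup>2} (standard_mult p (residue_scale p t)))"
proof -
  note p = assms(1)
  let ?std = "\<lambda>t. standard_mult p (residue_scale p t)"
  have coords: "\<exists>t e. affine_coordinates p t X m e" if "(X, m) \<in> indec_cyclic (p\<^sup>2)"
    for X :: "'a set" and m
    using indec_cyclic_prime_square_coordinates[OF p that] p
    by (auto simp: affine_coordinates_def affine_coordinates_axioms_def)
  have iso_coords: "\<exists>e'. affine_coordinates p t Y m' e'"
    if "affine_coordinates p t X m e" "cycle_set_iso X m Y m'"
    for t and X :: "'b set" and m e and Y :: "'c set" and m'
    using that translation_coordinates.transport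
    unfolding affine_coordinates_def cycle_set_iso_def by blast
  have iso: "cycle_set_iso X m Y m'"
    if "affine_coordinates p t X m e" "affine_coordinates p t Y m' e'"
    for t and X :: "'b set" and m e and Y :: "'c set" and m' e'
    using that translation_coordinates_iso by (auto simp: affine_coordinates_def)
  obtain A :: "'a set" where A: "card A = p\<^sup>2" using assms(2) by blast
  have "0 < p\<^sup>2" using prime_gt_0_nat[OF p] by simp
  then have "finite A" using A card_ge_0_finite by metis
  then obtain b where b: "bij_betw b {0..<p\<^sup>2} A"
    using ex_bij_betw_nat_finite A by metis
  define op where "op t x y = b (?std t (inv_into {0..<p\<^sup>2} b x) (inv_into {0..<p\<^sup>2} b y))" for t x y
  have "cycle_set_iso {0..<p\<^sup>2} (?std t) A (op t)" for t
    unfolding cycle_set_iso_def op_def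
    using b by (intro exI[of _ b]) (auto simp: bij_betw_inv_into_left)
  then have "\<exists>e. affine_coordinates p t A (op t) e" if "t < p" for t
    using iso_coords standard_affine_coordinates[OF p that] by blast
  then obtain e where e: "affine_coordinates p t A (op t) (e t)" if "t < p" for t by metis
  have irredundant: "t = t'"
    if t: "t < p" and t': "t' < p" and rel: "((A, op t), (A, op t')) \<in> iso_rel" for t t'
  proof -
    have "cycle_set_iso A (op t) A (op t')" using rel by (simp add: iso_rel_def)
    then obtain e' where "affine_coordinates p t A (op t') e'"
      using iso_coords[OF e[OF t]] by blast
    then show ?thesis using affine_coordinates_unique e[OF t'] by blast
  qed
  have count: "card (S // iso_rel) = card {t. t < p \<and> Q t}"
    if S: "S \<subseteq> indec_cyclic (p\<^sup>2)"
      and Q: "\<And>t X m e. affine_coordinates p t X m e \<Longrightarrow> (X, m) \<in> S \<longleftrightarrow> Q t"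
    for S :: "('a set \<times> ('a \<Rightarrow> 'a \<Rightarrow> 'a)) set" and Q
  proof (rule card_quotient_by_representatives[OF equiv_iso_rel, where N = "\<lambda>t. (A, op t)"])
    show "S \<subseteq> {(X, m). cycle_set X m}" using S by (auto simp: indec_cyclic_def)
    show "(A, op t) \<in> S" if "t \<in> {t. t < p \<and> Q t}" for t
      using that Q[OF e[of t]] by simp
    show "t = t'" if "t \<in> {t. t < p \<and> Q t}" "t' \<in> {t. t < p \<and> Q t}"
        "((A, op t), (A, op t')) \<in> iso_rel" for t t'
      using that irredundant by simp
    show "\<exists>t\<in>{t. t < p \<and> Q t}. (x, (A, op t)) \<in> iso_rel" if x: "x \<in> S" for x
    proof -
      obtain X m where Xm: "x = (X, m)" by (cases x)
      then obtain t e' where te: "affine_coordinates p t X m e'" using coords S x by blast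
      then interpret affine_coordinates p t X m e' .
      interpret A: affine_coordinates p t A "op t" "e t" by (rule e[OF t])
      have "(x, (A, op t)) \<in> iso_rel"
        using iso[OF te e[OF t]] cycle_set A.cycle_set by (simp add: Xm iso_rel_def)
      then show ?thesis using t Q[OF te] x Xm by blast
    qed
  qed
  have level_sub: "indec_cyclic_level (p\<^sup>2) k \<subseteq> (indec_cyclic (p\<^sup>2) :: ('a set \<times> _) set)" for k
    by (auto simp: indec_cyclic_level_def)
  have "card ((indec_cyclic (p\<^sup>2) :: ('a set \<times> ('a \<Rightarrow> 'a \<Rightarrow> 'a)) set) // iso_rel) = p"
  proof -
    have "card ((indec_cyclic (p\<^sup>2) :: ('a set \<times> ('a \<Rightarrow> 'a \<Rightarrow> 'a)) set) // iso_rel) = card {t. t < p \<and> True}"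
      by (rule count) (auto intro: affine_coordinates.in_indec_cyclic)
    then show ?thesis by simp
  qed
  moreover have "card ((indec_cyclic_level (p\<^sup>2) 2 :: ('a set \<times> ('a \<Rightarrow> 'a \<Rightarrow> 'a)) set) // iso_rel) = p - 1"
  proof -
    have "{t. t < p \<and> t \<noteq> 0} = {1..<p}" by auto
    then show ?thesis
      using count[OF level_sub affine_coordinates.in_indec_cyclic_level_iff(2)] by simp
  qed
  moreover have "card ((indec_cyclic_level (p\<^sup>2) 1 :: ('a set \<times> ('a \<Rightarrow> 'a \<Rightarrow> 'a)) set) // iso_rel) = 1"
  proof -
    have "{t. t < p \<and> t = 0} = {0}" using prime_gt_0_nat[OF p] by auto
    then show ?thesis
      using count[OF level_sub affine_coordinates.in_indec_cyclic_level_iff(1)] by simp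
  qed
  moreover have "({0..<p\<^sup>2}, ?std t) \<in> indec_cyclic_level (p\<^sup>2) 2" if "t \<in> {1..<p}" for t
    using affine_coordinates.in_indec_cyclic_level_iff(2)[OF standard_affine_coordinates[OF p, of t]] that
    by simp
  moreover have "\<forall>(X :: 'a set, m) \<in> indec_cyclic_level (p\<^sup>2) 2.
      \<exists>!t. t \<in> {1..<p} \<and> cycle_set_iso X m {0..<p\<^sup>2} (?std t)"
  proof (intro ballI case_prodI2)
    fix x X m assume "x \<in> indec_cyclic_level (p\<^sup>2) 2" "x = (X :: 'a set, m)"
    then have X: "(X, m) \<in> indec_cyclic_level (p\<^sup>2) 2" by simp
    have "(X, m) \<in> indec_cyclic (p\<^sup>2)" using X by (simp add: indec_cyclic_level_def)
    then obtain t e' where te: "affine_coordinates p t X m e'" using coords by blast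
    then interpret affine_coordinates p t X m e' .
    have "t \<in> {1..<p}" using in_indec_cyclic_level_iff(2) X t by simp
    moreover have "cycle_set_iso X m {0..<p\<^sup>2} (?std t)"
      by (rule iso[OF te standard_affine_coordinates[OF p t]])
    moreover have "t' = t" if t': "t' \<in> {1..<p}" "cycle_set_iso X m {0..<p\<^sup>2} (?std t')" for t'
      using iso_coords[OF te t'(2)] affine_coordinates_unique standard_affine_coordinates[OF p, of t'] t'(1)
      by (metis atLeastLessThan_iff)
    ultimately show "\<exists>!t. t \<in> {1..<p} \<and> cycle_set_iso X m {0..<p\<^sup>2} (?std t)" by blast
  qed
  ultimately show ?thesis using bij_betw_residue_scale[OF p] by blast
qed

end
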